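(* Let $T$ be a tree of radius $r\ge 1$. As $n\to\infty$: (1) If the diameter of $T$ is $2r$, then $\mathrm{ex}(n,T,2)=(1+o(1))\left(\binom{n}{2}+t_{n,r}\right)$. (2) If the diameter of $T$ is $2r-1$, then $\mathrm{ex}(n,T,2)=(1+o(1))\left(\binom{n}{2}+t'_{n,r}-\binom{\lfloor \frac{n}{2r-1}\rfloor}{2}\right)$.
   Context: All graphs are finite and simple. Let $n,q\ge 1$ be integers. For $\mathbf{x}\in\{0,1,\dots,q\}^n$ the support is $S_{\mathbf{x}}=\{i: x_i\neq 0\}$. Let $Q(n,2)=\{\mathbf{x}\in\{0,1,\dots,q\}^n: |S_{\mathbf{x}}|=2\}$; its elements are called $q$-edges, and a $q$-graph on $n$ vertices is a subset $H\subseteq Q(n,2)$. For a graph $F$ without isolated vertices and an integer $s\ge1$, a $q$-graph $H$ is an $s$-copy of $F$ if $|H|=|E(F)|$ and there is an isomorphism $\iota$ from $F$ to the graph with vertex set $\bigcup_{\mathbf{x}\in H}S_{\mathbf{x}}$ and edge set $\{S_{\mathbf{x}}:\mathbf{x}\in H\}$ such that, writing $\mathbf{x}^e$ for the unique element of $H$ with support $\iota(e)$, for all distinct $e,e'\in E(F)$ and $v\in e\cap e'$ we have $x^{e}_{\iota(v)}+x^{e'}_{\iota(v)}\ge s$. A $q$-graph contains an $s$-copy of $F$ if some subset of it is an $s$-copy of $F$. $\mathrm{ex}(n,F,q)$ is the maximum of $|H|$ over all $H\subseteq Q(n,2)$ containing no $(q+1)$-copy of $F$ (here $q=2$). The radius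 of a connected graph $G$ is $\min_{v\in V(G)}\max_{u\in V(G)}\mathrm{dist}(u,v)$. $t_{n,r}$ is the number of edges of the Turán graph $T(n,r)$, the complete $r$-partite graph on $n$ vertices with part sizes as equal as possible. $t'_{n,r}$ is the number of edges of the complete $r$-partite graph on $n$ vertices with one part of size $\lfloor\frac{n}{2r-1}\rfloor$ and the other $r-1$ parts having sizes differing by at most one (so of size $(1+o(1))\frac{2n}{2r-1}$). *)

theory Defs
  imports Complex_Main "HOL-Library.Landau_Symbols"
begin

section \<open>Finite simple graphs and trees\<close>

definition ugraph :: "'a set \<Rightarrow> 'a set set \<Rightarrow> bool" where
  "ugraph V E \<longleftrightarrow> finite V \<and> E \<subseteq> {e. e \<subseteq> V \<and> card e = 2}"

definition adj :: "'a set set \<Rightarrow> ('a \<times> 'a) set" where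
  "adj E = {(u, v). {u, v} \<in> E}"

definition connected_graph :: "'a set \<Rightarrow> 'a set set \<Rightarrow> bool" where
  "connected_graph V E \<longleftrightarrow> V \<noteq> {} \<and> (\<forall>u\<in>V. \<forall>v\<in>V. (u, v) \<in> (adj E)\<^sup>*)"

definition is_cycle :: "'a set set \<Rightarrow> 'a list \<Rightarrow> bool" where
  "is_cycle E c \<longleftrightarrow> length c \<ge> 3 \<and> distinct c \<and>
     (\<forall>i<length c. {c ! i, c ! (Suc i mod length c)} \<in> E)"

definition is_tree :: "'a set \<Rightarrow> 'a set set \<Rightarrow> bool" where
  "is_tree V E \<longleftrightarrow> ugraph V E \<and> connected_graph V E \<and> (\<nexists>c. is_cycle E c)"

text \<open>The relational power \<open>adj E ^^ k\<close> relates the end points of walks with \<open>k\<close> edges.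
  The next three notions are only meaningful for finite connected graphs.\<close>

definition graph_dist :: "'a set set \<Rightarrow> 'a \<Rightarrow> 'a \<Rightarrow> nat" where
  "graph_dist E u v = (LEAST k. (u, v) \<in> adj E ^^ k)"

definition radius :: "'a set \<Rightarrow> 'a set set \<Rightarrow> nat" where
  "radius V E = (MIN v\<in>V. MAX u\<in>V. graph_dist E u v)"

definition diameter :: "'a set \<Rightarrow> 'a set set \<Rightarrow> nat" where
  "diameter V E = (MAX v\<in>V. MAX u\<in>V. graph_dist E u v)"

definition graph_iso :: "('a \<Rightarrow> 'b) \<Rightarrow> 'a set \<Rightarrow> 'a set set \<Rightarrow> 'b set \<Rightarrow> 'b set set \<Rightarrow> bool" where
  "graph_iso \<iota> V E V' E' \<longleftrightarrow> bij_betw \<iota> V V' \<and>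
     (\<forall>u\<in>V. \<forall>v\<in>V. {u, v} \<in> E \<longleftrightarrow> {\<iota> u, \<iota> v} \<in> E')"


section \<open>\<open>q\<close>-graphs and \<open>s\<close>-copies\<close>

text \<open>A vector of length \<open>n\<close> is a function on the naturals, with coordinates indexed by
  \<open>{..<n}\<close> and value \<open>0\<close> at every other index; its support is thus contained in \<open>{..<n}\<close>.\<close>

definition supp :: "(nat \<Rightarrow> nat) \<Rightarrow> nat set" where
  "supp x = {i. x i \<noteq> 0}"

definition qvectors :: "nat \<Rightarrow> nat \<Rightarrow> (nat \<Rightarrow> nat) set" where
  "qvectors n q = {x. (\<forall>i<n. x i \<in> {0..q}) \<and> (\<forall>i\<ge>n. x i = 0)}"

definition qedges :: "nat \<Rightarrow> nat \<Rightarrow> (nat \<Rightarrow> nat) set" where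
  "qedges n q = {x \<in> qvectors n q. card (supp x) = 2}"

text \<open>In an \<open>s\<close>-copy the vector with a given support is unique, because
  \<open>card H = card E = card (supp ` H)\<close>; quantifying over all \<open>x, x' \<in> H\<close> with the right
  supports therefore refers to exactly one vector for each of \<open>e\<close> and \<open>e'\<close>.\<close>

definition s_copy :: "nat \<Rightarrow> 'a set \<Rightarrow> 'a set set \<Rightarrow> (nat \<Rightarrow> nat) set \<Rightarrow> bool" where
  "s_copy s V E H \<longleftrightarrow> card H = card E \<and>
     (\<exists>\<iota>. graph_iso \<iota> V E (\<Union>x\<in>H. supp x) (supp ` H) \<and>
       (\<forall>e\<in>E. \<forall>e'\<in>E. e \<noteq> e' \<longrightarrow> (\<forall>v \<in> e \<inter> e'. \<forall>x\<in>H. \<forall>x'\<in>H.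
          supp x = \<iota> ` e \<longrightarrow> supp x' = \<iota> ` e' \<longrightarrow> x (\<iota> v) + x' (\<iota> v) \<ge> s)))"

definition contains_s_copy :: "nat \<Rightarrow> 'a set \<Rightarrow> 'a set set \<Rightarrow> (nat \<Rightarrow> nat) set \<Rightarrow> bool" where
  "contains_s_copy s V E H \<longleftrightarrow> (\<exists>H'\<subseteq>H. s_copy s V E H')"

definition ex_num :: "nat \<Rightarrow> 'a set \<Rightarrow> 'a set set \<Rightarrow> nat \<Rightarrow> nat" where
  "ex_num n V E q = Max {card H | H. H \<subseteq> qedges n q \<and> \<not> contains_s_copy (q + 1) V E H}"

lemma finite_qedges: "finite (qedges n q)"
proof -
  have "qedges n q \<subseteq> {x. \<forall>i. (i \<in> {..<n} \<longrightarrow> x i \<in> {0..q}) \<and> (i \<notin> {..<n} \<longrightarrow> x i = 0)}"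
    by (auto simp: qedges_def qvectors_def)
  then show ?thesis
    by (rule finite_subset) (rule finite_set_of_finite_funs; simp)
qed

lemma ex_num_well_defined:
  assumes "finite E" "E \<noteq> {}"
  shows "finite {card H | H. H \<subseteq> qedges n q \<and> \<not> contains_s_copy (q + 1) V E H}"
    and "{card H | H. H \<subseteq> qedges n q \<and> \<not> contains_s_copy (q + 1) V E H} \<noteq> {}"
proof -
  have "{card H | H. H \<subseteq> qedges n q \<and> \<not> contains_s_copy (q + 1) V E H}
      \<subseteq> card ` Pow (qedges n q)" by auto
  then show "finite {card H | H. H \<subseteq> qedges n q \<and> \<not> contains_s_copy (q + 1) V E H}"
    by (rule finite_subset) (simp add: finite_qedges)
  have "\<not> contains_s_copy (q + 1) V E {}"
    using assms by (auto simp: contains_s_copy_def s_copy_def)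
  then show "{card H | H. H \<subseteq> qedges n q \<and> \<not> contains_s_copy (q + 1) V E H} \<noteq> {}"
    by blast
qed


section \<open>Complete multipartite graphs\<close>

definition multipartite_edges :: "nat \<Rightarrow> (nat \<Rightarrow> nat) \<Rightarrow> nat set set" where
  "multipartite_edges n c = {{i, j} | i j. i < n \<and> j < n \<and> c i \<noteq> c j}"

text \<open>The parts of the Turan graph are taken to be the residue classes modulo \<open>r\<close>.\<close>

definition turan_num :: "nat \<Rightarrow> nat \<Rightarrow> nat" where
  "turan_num n r = card (multipartite_edges n (\<lambda>i. i mod r))"

text \<open>The part of prescribed size is \<open>{..<m}\<close> with \<open>m = n div (2 * r - 1)\<close>; the remaining
  \<open>n - m\<close> vertices are split into \<open>r - 1\<close> parts by the residue of \<open>i - m\<close> modulo \<open>r - 1\<close>.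
  For \<open>r = 1\<close> we have \<open>m = n\<close>, so that there are no remaining vertices and no edges.\<close>

definition turan'_part :: "nat \<Rightarrow> nat \<Rightarrow> nat \<Rightarrow> nat" where
  "turan'_part n r i = (let m = n div (2 * r - 1) in
     if i < m then 0 else Suc ((i - m) mod (r - 1)))"

definition turan'_num :: "nat \<Rightarrow> nat \<Rightarrow> nat" where
  "turan'_num n r = card (multipartite_edges n (turan'_part n r))"

lemma card_residue_class:
  fixes n r k :: nat
  assumes "k < r"
  shows "card {i. i < n \<and> i mod r = k} \<in> {n div r, n div r + 1}"
proof -
  have lt: "k + r * j < n \<longleftrightarrow> j < n div r + (if k < n mod r then 1 else 0)" for j
  proof -
    have n: "n = r * (n div r) + n mod r" "n mod r < r" using assms by auto
    consider "j < n div r" | "j = n div r" | "Suc (n div r) \<le> j" by linarith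
    then show ?thesis
    proof cases
      case 1
      then have "r * Suc j \<le> r * (n div r)" by (intro mult_le_mono2) simp
      then have "k + r * j < r * (n div r)" using assms by (simp only: mult_Suc_right)
      then have "k + r * j < n" using n(1) by linarith
      with 1 show ?thesis by simp
    next
      case 2
      have "k + r * j < n \<longleftrightarrow> k < n mod r" using 2 n(1) by (metis add.commute add_less_cancel_left)
      with 2 show ?thesis by simp
    next
      case 3
      then have "r * Suc (n div r) \<le> r * j" by (intro mult_le_mono2)
      then have "n < r * j" using n by (simp only: mult_Suc_right)
      then have "\<not> k + r * j < n" by linarith
      with 3 show ?thesis by simp
    qed
  qed
  have "{i. i < n \<and> i mod r = k}
      = (\<lambda>j. k + r * j) ` {..<n div r + (if k < n mod r then 1 else 0)}" (is "?L = ?R")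
  proof (intro equalityI subsetI)
    fix i assume "i \<in> ?L"
    then have "i = k + r * (i div r)" "k + r * (i div r) < n"
      using mod_mult_div_eq[of i r] by auto
    then show "i \<in> ?R" using lt by blast
  next
    fix i assume "i \<in> ?R"
    then obtain j where "i = k + r * j" "k + r * j < n" using lt by blast
    then show "i \<in> ?L" using assms by auto
  qed
  moreover have "inj (\<lambda>j. k + r * j)" using assms by (auto simp: inj_on_def)
  ultimately show ?thesis by (simp add: card_image inj_on_subset)
qed

lemma card_turan'_part_0:
  "card {i. i < n \<and> turan'_part n r i = 0} = n div (2 * r - 1)"
proof -
  have "{i. i < n \<and> turan'_part n r i = 0} = {..<n div (2 * r - 1)}"
    using less_le_trans[OF _ div_le_dividend[of n "2 * r - 1"]]
    unfolding turan'_part_def Let_def by (intro set_eqI) (auto split: if_splits)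
  then show ?thesis by simp
qed

lemma card_turan'_part_Suc:
  fixes n r k :: nat
  assumes "k < r - 1"
  defines "m \<equiv> n div (2 * r - 1)"
  shows "card {i. i < n \<and> turan'_part n r i = Suc k}
           \<in> {(n - m) div (r - 1), (n - m) div (r - 1) + 1}"
proof -
  have "{i. i < n \<and> turan'_part n r i = Suc k}
      = (\<lambda>i. i + m) ` {i. i < n - m \<and> i mod (r - 1) = k}" (is "?L = ?R")
  proof (intro equalityI subsetI)
    fix i assume i: "i \<in> ?L"
    then have "m \<le> i" unfolding turan'_part_def m_def Let_def by (auto split: if_splits)
    with i have "i = (i - m) + m" "i - m \<in> {i. i < n - m \<and> i mod (r - 1) = k}"
      unfolding turan'_part_def m_def[symmetric] Let_def by auto
    then show "i \<in> ?R" by blast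
  next
    fix i assume "i \<in> ?R"
    then show "i \<in> ?L" unfolding turan'_part_def m_def[symmetric] Let_def by auto
  qed
  then show ?thesis
    using card_residue_class[OF assms(1), of "n - m"] by (simp add: card_image)
qed

end

theory Submission
  imports Defs
begin

text \<open>Write \<open>d\<close> for the diameter of the tree, so \<open>d\<close> is \<open>2 * r\<close> or \<open>2 * r - 1\<close>. Both
  formulas are \<open>(1 - 1 / d) * n\<^sup>2 + O(n)\<close>, and so is the extremal number. With labels \<open>1\<close> and
  \<open>2\<close>, the condition on a \<open>3\<close>-copy says that every vertex of the copy has at most one incident
  edge carrying label \<open>1\<close> at that vertex. A vector with label \<open>2\<close> at \<open>u\<close> and any label at \<open>v\<close> is
  regarded as an arc from \<open>u\<close> to \<open>v\<close>: if the tree is rooted and every edge is embedded as an arc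
  from parent to child, then the only label \<open>1\<close> at a vertex can be on the edge to its parent.

  Lower bound (\<open>layered_no_copy\<close>). Colour the vertices with \<open>r\<close> colours, take the vector
  \<open>(1, 1)\<close> on every pair and an arc from the lower to the higher colour on every pair of
  different colours. Along a path of a copy, once an edge has label \<open>1\<close> at its far end, all later
  edges are arcs pointing forward, and symmetrically before it; so the path consists of backward
  arcs, at most one \<open>(1, 1)\<close> edge, and forward arcs. Since there are only \<open>r\<close> colours, it has at
  most \<open>2 * r - 1\<close> edges, with equality only if its \<open>(1, 1)\<close> edge joins two vertices of
  colour \<open>0\<close>. A diametral path thus rules out diameter \<open>2 * r\<close>, and also diameter \<open>2 * r - 1\<close> if
  the \<open>(1, 1)\<close> vectors inside colour \<open>0\<close> are deleted.

  Upper bound (\<open>card_le_of_no_copy\<close>). Call a vertex rich of order \<open>k + 1\<close> if it has at least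
  \<open>card V\<close> arcs to vertices that are rich of order \<open>k\<close>. From a vertex rich of order \<open>h\<close> one can
  embed greedily any tree of depth \<open>h\<close> with at most \<open>card V\<close> vertices. If there is no copy, then no vertex is rich of order
  \<open>r\<close>, because the tree can be rooted at its centre; if the diameter is \<open>2 * r - 1\<close>, no vector at all
  joins two vertices that are rich of order \<open>r - 1\<close>, because these could host the central edge
  (\<open>tree_central_edge\<close>). Colouring each vertex by the largest order of its richness gives \<open>r\<close>
  colours such that all but \<open>O(n)\<close> arcs go to a strictly lower colour. Up to \<open>O(n)\<close>, the
  host therefore has the shape of the construction, with unknown colour class sizes. Optimising
  these sizes is the minimisation of a weighted sum of squares, which yields \<open>(1 - 1 / d) * n\<^sup>2\<close>.\<close>

section \<open>Distances and geodesics\<close>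

lemma adj_commute: "(u, v) \<in> adj E \<longleftrightarrow> (v, u) \<in> adj E"
  by (simp add: adj_def insert_commute)

lemma walk_commute: "(u, v) \<in> adj E ^^ k \<Longrightarrow> (v, u) \<in> adj E ^^ k"
proof (induction k arbitrary: v)
  case (Suc k)
  then obtain y where "(u, y) \<in> adj E ^^ k" "(y, v) \<in> adj E" by auto
  with Suc.IH show ?case by (meson adj_commute relpow_Suc_I2)
qed simp

lemma reach_commute: "(u, v) \<in> (adj E)\<^sup>* \<Longrightarrow> (v, u) \<in> (adj E)\<^sup>*"
  by (metis rtrancl_power walk_commute)

lemma reach_mono: "E \<subseteq> F \<Longrightarrow> (u, v) \<in> (adj E)\<^sup>* \<Longrightarrow> (u, v) \<in> (adj F)\<^sup>*"
  using rtrancl_mono[of "adj E" "adj F"] by (auto simp: adj_def)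

lemma graph_dist_le: "(u, v) \<in> adj E ^^ k \<Longrightarrow> graph_dist E u v \<le> k"
  unfolding graph_dist_def by (rule Least_le)

lemma graph_dist_walk: "(u, v) \<in> (adj E)\<^sup>* \<Longrightarrow> (u, v) \<in> adj E ^^ graph_dist E u v"
  unfolding graph_dist_def by (rule LeastI_ex) (simp add: rtrancl_power)

lemma graph_dist_commute: "graph_dist E u v = graph_dist E v u"
  unfolding graph_dist_def by (metis walk_commute)

definition geodesic :: "'a set set \<Rightarrow> (nat \<Rightarrow> 'a) \<Rightarrow> nat \<Rightarrow> bool" where
  "geodesic E p d \<longleftrightarrow> (\<forall>i<d. (p i, p (Suc i)) \<in> adj E) \<and> graph_dist E (p 0) (p d) = d"

lemma geodesic_exists:
  assumes "(u, v) \<in> (adj E)\<^sup>*"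
  obtains p where "geodesic E p (graph_dist E u v)" "p 0 = u" "p (graph_dist E u v) = v"
proof -
  obtain p where "p 0 = u" "p (graph_dist E u v) = v"
    "\<forall>i<graph_dist E u v. (p i, p (Suc i)) \<in> adj E"
    using graph_dist_walk[OF assms] unfolding relpow_fun_conv by metis
  then show ?thesis by (intro that[of p]) (auto simp: geodesic_def)
qed

lemma walk_along:
  assumes "\<forall>i<d. (p i, p (Suc i)) \<in> adj E" "i \<le> j" "j \<le> d"
  shows "(p i, p j) \<in> adj E ^^ (j - i)"
  unfolding relpow_fun_conv using assms by (intro exI[of _ "\<lambda>k. p (i + k)"]) auto

lemma geodesic_dist:
  assumes "geodesic E p d" "i \<le> j" "j \<le> d"
  shows "graph_dist E (p i) (p j) = j - i"
proof -
  have w: "\<forall>i<d. (p i, p (Suc i)) \<in> adj E" and d: "graph_dist E (p 0) (p d) = d"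
    using assms by (auto simp: geodesic_def)
  have ij: "(p i, p j) \<in> adj E ^^ (j - i)" using walk_along[OF w] assms by blast
  have "(p 0, p i) \<in> adj E ^^ i" using walk_along[OF w, of 0 i] assms by simp
  moreover have "(p i, p j) \<in> adj E ^^ graph_dist E (p i) (p j)"
    using ij by (intro graph_dist_walk) (auto simp: rtrancl_power)
  moreover have "(p j, p d) \<in> adj E ^^ (d - j)" using walk_along[OF w, of j d] assms by simp
  ultimately have "(p 0, p d) \<in> adj E ^^ (i + graph_dist E (p i) (p j) + (d - j))"
    by (auto simp: relpow_add)
  then have "d \<le> i + graph_dist E (p i) (p j) + (d - j)" using graph_dist_le d by metis
  with graph_dist_le[OF ij] assms show ?thesis by linarith
qed

lemma geodesic_inj:
  assumes "geodesic E p d"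
  shows "inj_on p {..d}"
proof (rule linorder_inj_onI')
  fix i j assume ij: "i \<in> {..d}" "j \<in> {..d}" "i < j"
  have "graph_dist E (p i) (p i) = 0" using geodesic_dist[OF assms, of i i] ij by simp
  moreover have "graph_dist E (p i) (p j) = j - i" using geodesic_dist[OF assms] ij by simp
  ultimately show "p i \<noteq> p j" using ij by auto
qed

lemma diameter_ge:
  assumes "finite V" "u \<in> V" "v \<in> V"
  shows "graph_dist E u v \<le> diameter V E"
proof -
  have "graph_dist E u v \<le> (MAX u\<in>V. graph_dist E u v)" using assms by (intro Max_ge) auto
  also have "\<dots> \<le> diameter V E" unfolding diameter_def using assms by (intro Max_ge) auto
  finally show ?thesis .
qed

lemma diameter_attained:
  assumes "finite V" "V \<noteq> {}"
  obtains u v where "u \<in> V" "v \<in> V" "graph_dist E u v = diameter V E"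
proof -
  have "diameter V E \<in> (\<lambda>v. MAX u\<in>V. graph_dist E u v) ` V"
    unfolding diameter_def using assms by (intro Max_in) auto
  then obtain v where v: "v \<in> V" "diameter V E = (MAX u\<in>V. graph_dist E u v)" by blast
  have "(MAX u\<in>V. graph_dist E u v) \<in> (\<lambda>u. graph_dist E u v) ` V"
    using assms by (intro Max_in) auto
  with v that show ?thesis by force
qed

lemma radius_attained:
  assumes "finite V" "V \<noteq> {}"
  obtains w where "w \<in> V" "\<And>u. u \<in> V \<Longrightarrow> graph_dist E w u \<le> radius V E"
proof -
  have "radius V E \<in> (\<lambda>v. MAX u\<in>V. graph_dist E u v) ` V"
    unfolding radius_def using assms by (intro Min_in) auto
  then obtain w where w: "w \<in> V" "radius V E = (MAX u\<in>V. graph_dist E u w)" by blast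
  have "graph_dist E w u \<le> radius V E" if "u \<in> V" for u
    unfolding w(2) graph_dist_commute[of E w u] using that assms by (intro Max_ge) auto
  with w that show ?thesis by blast
qed

section \<open>Trees\<close>

text \<open>Otherwise a geodesic from \<open>u\<close> to \<open>v\<close> that avoids the edge would be closed to a cycle by it.
  This is the only use of acyclicity.\<close>
lemma tree_edge_is_bridge:
  assumes acyclic: "\<nexists>c. is_cycle E c" and e: "{u, v} \<in> E" "u \<noteq> v"
  shows "(u, v) \<notin> (adj (E - {{u, v}}))\<^sup>*"
proof
  let ?F = "E - {{u, v}}"
  assume "(u, v) \<in> (adj ?F)\<^sup>*"
  then obtain p where p: "geodesic ?F p (graph_dist ?F u v)" "p 0 = u"
    "p (graph_dist ?F u v) = v" by (rule geodesic_exists)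
  define k where "k = graph_dist ?F u v"
  have step: "{p i, p (Suc i)} \<in> ?F" if "i < k" for i
    using p(1) that by (auto simp: geodesic_def adj_def k_def)
  have "k \<noteq> 0" using p e unfolding k_def by (metis)
  moreover have "k \<noteq> 1" using step[of 0] p by (auto simp: k_def)
  ultimately have "k \<ge> 2" by linarith
  define c where "c = map p [0..<Suc k]"
  have nth: "c ! i = p i" if "i \<le> k" for i using that by (simp add: c_def del: upt_Suc)
  have len: "length c = Suc k" by (simp add: c_def)
  have "distinct c" using geodesic_inj[OF p(1)] unfolding c_def distinct_map k_def
    by (auto simp del: upt_Suc elim: inj_on_subset)
  moreover have "{c ! i, c ! (Suc i mod length c)} \<in> E" if "i < length c" for i
  proof (cases "i = k")
    case True
    then show ?thesis using e p nth[of k] nth[of 0] by (simp add: len k_def insert_commute)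
  next
    case False
    with that have "i < k" by (simp add: len)
    then show ?thesis using step[of i] nth[of i] nth[of "Suc i"] by (simp add: len)
  qed
  ultimately have "is_cycle E c" using \<open>k \<ge> 2\<close> unfolding is_cycle_def len by auto
  with acyclic show False by blast
qed

text \<open>Cut the walk at its first use of \<open>e\<close>; up to there it lives in \<open>E - {e}\<close>. This fixes which end
  of \<open>e\<close> is met first, and hence gives exact lower bounds for distances across a bridge.\<close>
lemma walk_crosses_cut_edge:
  assumes "(v, z) \<in> adj E ^^ k" "(v, z) \<notin> (adj (E - {e}))\<^sup>*"
  obtains y y' i j where "{y, y'} = e" "k = Suc (i + j)" "(v, y) \<in> (adj (E - {e}))\<^sup>*"
    "(v, y) \<in> adj E ^^ i" "(y', z) \<in> adj E ^^ j"
  using assms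
proof (induction k arbitrary: z thesis)
  case (Suc k)
  obtain x where x: "(v, x) \<in> adj E ^^ k" "(x, z) \<in> adj E" using Suc.prems(2) by auto
  show ?case
  proof (cases "(v, x) \<in> (adj (E - {e}))\<^sup>*")
    case True
    with Suc.prems(3) have "(x, z) \<notin> adj (E - {e})" by (meson rtrancl.rtrancl_into_rtrancl)
    with x have "{x, z} = e" by (auto simp: adj_def)
    with True x Suc.prems(1)[of x z k 0] show ?thesis by auto
  next
    case False
    obtain y y' i j where "{y, y'} = e" "k = Suc (i + j)"
      "(v, y) \<in> (adj (E - {e}))\<^sup>*" "(v, y) \<in> adj E ^^ i" "(y', x) \<in> adj E ^^ j"
      by (rule Suc.IH[OF _ x(1) False])
    with x Suc.prems(1)[of y y' i "Suc j"] show ?thesis by auto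
  qed
qed simp

text \<open>The edge \<open>{a, b}\<close> is the middle edge of a diametral path from \<open>u\<close> to \<open>v\<close>. Being a bridge, it
  separates any vertex \<open>w\<close> from \<open>u\<close> or from \<open>v\<close>. If it separates \<open>w\<close> from \<open>v\<close>, the walk from \<open>w\<close> to
  \<open>v\<close> passes through \<open>a\<close> and then \<open>b\<close>, so the distance from \<open>w\<close> to \<open>a\<close>, plus \<open>1\<close>, plus \<open>r - 1\<close>, is
  at most the diameter.\<close>
lemma tree_central_edge:
  assumes tree: "is_tree V E" and diam: "diameter V E = 2 * r - 1" and r: "r \<ge> 1"
  obtains a b where "{a, b} \<in> E" "a \<in> V" "b \<in> V" "a \<noteq> b"
    "\<forall>v\<in>V. graph_dist E a v \<le> r - 1 \<or> graph_dist E b v \<le> r - 1"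
proof -
  have fin: "finite V" and ne: "V \<noteq> {}" and acyc: "\<nexists>c. is_cycle E c"
    and EV: "\<And>e. e \<in> E \<Longrightarrow> e \<subseteq> V"
    and conn: "\<And>u v. u \<in> V \<Longrightarrow> v \<in> V \<Longrightarrow> (u, v) \<in> (adj E)\<^sup>*"
    using tree by (auto simp: is_tree_def ugraph_def connected_graph_def)
  obtain u v where uv: "u \<in> V" "v \<in> V" "graph_dist E u v = 2 * r - 1"
    using diameter_attained[OF fin ne, of E] diam by metis
  obtain p where p: "geodesic E p (2 * r - 1)" "p 0 = u" "p (2 * r - 1) = v"
    using geodesic_exists[OF conn[OF uv(1,2)]] uv(3) by metis
  define a b where "a = p (r - 1)" and "b = p r"
  have step: "{p i, p (Suc i)} \<in> E" if "i < 2 * r - 1" for i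
    using p(1) that by (auto simp: geodesic_def adj_def)
  have inj: "p i = p j \<longleftrightarrow> i = j" if "i \<le> 2 * r - 1" "j \<le> 2 * r - 1" for i j
    using geodesic_inj[OF p(1)] that by (auto simp: inj_on_def)
  have ab: "{a, b} \<in> E" using step[of "r - 1"] r by (simp add: a_def b_def)
  have "a \<noteq> b" using inj[of "r - 1" r] r by (simp add: a_def b_def)
  note bridge = tree_edge_is_bridge[OF acyc ab this]
  let ?F = "E - {{a, b}}"
  have off: "(p i, p (Suc i)) \<in> adj ?F" if "i < 2 * r - 1" "i \<noteq> r - 1" for i
  proof -
    have "p i \<noteq> a \<or> p (Suc i) \<noteq> b" using inj[of i "r - 1"] that by (simp add: a_def)
    moreover have "p i \<noteq> b \<or> p (Suc i) \<noteq> a"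
      using inj[of i r] inj[of "Suc i" "r - 1"] that r by (auto simp: a_def b_def)
    ultimately show ?thesis using step[of i] that by (auto simp: adj_def doubleton_eq_iff)
  qed
  have ua: "(u, a) \<in> (adj ?F)\<^sup>*"
  proof -
    have "(p 0, p (r - 1)) \<in> adj ?F ^^ (r - 1)"
      unfolding relpow_fun_conv using off r by (intro exI[of _ p]) auto
    then show ?thesis by (auto simp: rtrancl_power p a_def)
  qed
  have bv: "(b, v) \<in> (adj ?F)\<^sup>*"
  proof -
    have "(p r, p (r + (r - 1))) \<in> adj ?F ^^ (r - 1)"
      unfolding relpow_fun_conv using off r by (intro exI[of _ "\<lambda>i. p (r + i)"]) auto
    moreover have "r + (r - 1) = 2 * r - 1" using r by simp
    ultimately show ?thesis using p by (auto simp: rtrancl_power b_def)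
  qed
  have da: "graph_dist E a u = r - 1" "graph_dist E b v = r - 1"
    using geodesic_dist[OF p(1), of 0 "r - 1"] geodesic_dist[OF p(1), of r "2 * r - 1"] r p
    by (auto simp: a_def b_def graph_dist_commute)
  have near: "graph_dist E a w \<le> r - 1 \<or> graph_dist E b w \<le> r - 1" if w: "w \<in> V" for w
  proof (cases "(w, b) \<in> (adj ?F)\<^sup>*")
    case False
    then have cut: "(w, v) \<notin> (adj ?F)\<^sup>*" using bv by (meson reach_commute rtrancl_trans)
    obtain y y' i j where y: "{y, y'} = {a, b}" "graph_dist E w v = Suc (i + j)"
      "(w, y) \<in> (adj ?F)\<^sup>*" "(w, y) \<in> adj E ^^ i" "(y', v) \<in> adj E ^^ j"
      by (rule walk_crosses_cut_edge[OF graph_dist_walk[OF conn[OF w uv(2)]] cut])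
    with False have "y = a" "y' = b" by (auto simp: doubleton_eq_iff)
    with y have "graph_dist E w a \<le> i" "r - 1 \<le> j" using graph_dist_le da by metis+
    with y(2) diameter_ge[OF fin w uv(2), of E] diam have "graph_dist E w a \<le> r - 1" by linarith
    then show ?thesis by (simp add: graph_dist_commute)
  next
    case True
    then have wa: "(w, a) \<notin> (adj ?F)\<^sup>*" using bridge by (meson reach_commute rtrancl_trans)
    then have cut: "(w, u) \<notin> (adj ?F)\<^sup>*" using ua by (meson rtrancl_trans)
    obtain y y' i j where y: "{y, y'} = {a, b}" "graph_dist E w u = Suc (i + j)"
      "(w, y) \<in> (adj ?F)\<^sup>*" "(w, y) \<in> adj E ^^ i" "(y', u) \<in> adj E ^^ j"
      by (rule walk_crosses_cut_edge[OF graph_dist_walk[OF conn[OF w uv(1)]] cut])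
    with wa have "y = b" "y' = a" by (auto simp: doubleton_eq_iff)
    with y have "graph_dist E w b \<le> i" "r - 1 \<le> j" using graph_dist_le da by metis+
    with y(2) diameter_ge[OF fin w uv(1), of E] diam have "graph_dist E w b \<le> r - 1" by linarith
    then show ?thesis by (simp add: graph_dist_commute)
  qed
  have "a \<in> V" "b \<in> V" using EV[OF ab] by auto
  from that[OF ab this \<open>a \<noteq> b\<close>] near show ?thesis by simp
qed

text \<open>Send each vertex outside the root set to a neighbour nearer to the roots. The edges obtained in
  this way, together with \<open>ER\<close>, connect everything, so any further edge of the tree would not be
  a bridge. The function \<open>g\<close> bounds from above the height of the subtree hanging from a
  vertex: it equals \<open>h\<close> at the roots and drops from parent to child. The root set will be a
  single vertex or the two ends of the central edge.\<close>
lemma tree_rooted_decomposition: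
  assumes tree: "is_tree V E" and R: "R \<subseteq> V" and ER: "ER \<subseteq> E"
    and ER_conn: "\<And>x y. x \<in> R \<Longrightarrow> y \<in> R \<Longrightarrow> (x, y) \<in> (adj ER)\<^sup>*"
    and near: "\<And>v. v \<in> V \<Longrightarrow> \<exists>w\<in>R. graph_dist E w v \<le> h"
  shows "\<exists>par g. (\<forall>v\<in>V - R. par v \<in> V \<and> g v < g (par v)) \<and> (\<forall>w\<in>R. g w = h)
           \<and> E = ER \<union> (\<lambda>v. {v, par v}) ` (V - R)"
proof -
  have acyc: "\<nexists>c. is_cycle E c" and E2: "\<And>e. e \<in> E \<Longrightarrow> e \<subseteq> V \<and> card e = 2"
    and conn: "\<And>u v. u \<in> V \<Longrightarrow> v \<in> V \<Longrightarrow> (u, v) \<in> (adj E)\<^sup>*"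
    using tree by (auto simp: is_tree_def ugraph_def connected_graph_def)
  \<comment> \<open>The distance from \<open>v\<close> to the root set.\<close>
  define d where "d v = (LEAST k. \<exists>w\<in>R. (w, v) \<in> adj E ^^ k)" for v
  have d_le: "d v \<le> k" if "w \<in> R" "(w, v) \<in> adj E ^^ k" for v w k
    unfolding d_def using that by (intro Least_le) blast
  have d_walk: "\<exists>w\<in>R. (w, v) \<in> adj E ^^ d v" and d_h: "d v \<le> h" if v: "v \<in> V" for v
  proof -
    obtain w where w: "w \<in> R" "graph_dist E w v \<le> h" using near[OF v] by blast
    then have *: "(w, v) \<in> adj E ^^ graph_dist E w v" using R v conn by (intro graph_dist_walk) auto
    show "\<exists>w\<in>R. (w, v) \<in> adj E ^^ d v"
      unfolding d_def by (rule LeastI_ex) (use w * in blast)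
    show "d v \<le> h" using d_le[OF w(1) *] w(2) by simp
  qed
  have "\<exists>y\<in>V. d y < d v \<and> {v, y} \<in> E" if v: "v \<in> V - R" for v
  proof -
    obtain w where w: "w \<in> R" "(w, v) \<in> adj E ^^ d v" using d_walk v by blast
    with v have "d v \<noteq> 0" by (intro notI) auto
    then obtain k where k: "d v = Suc k" using not0_implies_Suc by blast
    with w obtain y where y: "(w, y) \<in> adj E ^^ k" "(y, v) \<in> adj E" by auto
    then have "{v, y} \<in> E" by (simp add: adj_def insert_commute)
    moreover have "y \<in> V" using E2[OF calculation] by auto
    moreover have "d y < d v" using d_le[OF w(1) y(1)] k by simp
    ultimately show ?thesis by blast
  qed
  then obtain par where par: "\<And>v. v \<in> V - R \<Longrightarrow> par v \<in> V \<and> d (par v) < d v \<and> {v, par v} \<in> E"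
    by metis
  define F where "F = ER \<union> (\<lambda>v. {v, par v}) ` (V - R)"
  have FE: "F \<subseteq> E" using ER par by (auto simp: F_def)
  have root: "\<exists>w\<in>R. (v, w) \<in> (adj F)\<^sup>*" if "v \<in> V" for v
    using that
  proof (induction "d v" arbitrary: v rule: less_induct)
    case less
    show ?case
    proof (cases "v \<in> R")
      case False
      with less.prems have v: "v \<in> V - R" by simp
      obtain w where "w \<in> R" "(par v, w) \<in> (adj F)\<^sup>*" using less.hyps[of "par v"] par[OF v] by blast
      moreover have "(v, par v) \<in> adj F" using v by (auto simp: adj_def F_def)
      ultimately show ?thesis by (meson converse_rtrancl_into_rtrancl)
    qed blast
  qed
  have "E \<subseteq> F"
  proof (rule subsetI, rule ccontr)
    fix e assume e: "e \<in> E" "e \<notin> F"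
    obtain u v where uv: "e = {u, v}" "u \<noteq> v" "u \<in> V" "v \<in> V"
      using E2[OF e(1)] by (auto simp: card_2_iff)
    obtain w w' where w: "w \<in> R" "w' \<in> R" "(u, w) \<in> (adj F)\<^sup>*" "(v, w') \<in> (adj F)\<^sup>*"
      using root uv by blast
    have "(w, w') \<in> (adj F)\<^sup>*"
      by (rule reach_mono[OF _ ER_conn[OF w(1,2)]]) (simp add: F_def)
    with w have "(u, v) \<in> (adj F)\<^sup>*" by (meson reach_commute rtrancl_trans)
    then have "(u, v) \<in> (adj (E - {e}))\<^sup>*" by (rule reach_mono[rotated]) (use FE e in blast)
    with tree_edge_is_bridge[OF acyc, of u v] e uv show False by blast
  qed
  with FE have EF: "E = F" by blast
  have dR: "d w = 0" if "w \<in> R" for w using d_le[OF that, of w 0] by simp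
  have "h - d v < h - d (par v)" if "v \<in> V - R" for v
    using par[OF that] d_h[of v] that by auto
  then show ?thesis using par dR EF
    by (intro exI[of _ par] exI[of _ "\<lambda>v. h - d v"]) (simp add: F_def)
qed

section \<open>Greedy embedding\<close>

definition arc :: "(nat \<Rightarrow> nat) set \<Rightarrow> nat \<Rightarrow> nat \<Rightarrow> bool" where
  "arc H u v \<longleftrightarrow> (\<exists>x\<in>H. u \<noteq> v \<and> supp x = {u, v} \<and> x u = 2)"

text \<open>A vertex of \<open>rich H n M k\<close> is the root of a \<open>k\<close>-level tree of arcs in which every inner vertex
  has at least \<open>M\<close> children, where vertices on different branches may coincide.\<close>
primrec rich :: "(nat \<Rightarrow> nat) set \<Rightarrow> nat \<Rightarrow> nat \<Rightarrow> nat \<Rightarrow> nat set" where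
  "rich H n M 0 = {..<n}"
| "rich H n M (Suc k) = {u. u < n \<and> M \<le> card {v \<in> rich H n M k. arc H u v}}"

lemma rich_lessThan: "rich H n M k \<subseteq> {..<n}"
  by (cases k) auto

lemma finite_rich: "finite (rich H n M k)"
  using rich_lessThan finite_lessThan by (rule finite_subset)

lemma rich_Suc_subset: "rich H n M (Suc k) \<subseteq> rich H n M k"
proof (induction k)
  case (Suc k)
  have "card {v \<in> rich H n M (Suc k). arc H u v} \<le> card {v \<in> rich H n M k. arc H u v}" for u
    using Suc.IH by (intro card_mono) (auto simp: finite_rich simp del: rich.simps)
  then show ?case by (auto intro: order_trans)
qed auto

lemma rich_antimono: "k \<le> l \<Longrightarrow> rich H n M l \<subseteq> rich H n M k"
  by (rule lift_Suc_antimono_le[of "rich H n M"]) (rule rich_Suc_subset)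

text \<open>Embed the vertices outside \<open>R\<close> in order of decreasing \<open>g\<close>, so that parents come first. When
  \<open>v\<close> is embedded, its parent sits on a vertex with at least \<open>M\<close> suitable out-neighbours, and fewer
  than \<open>M\<close> vertices are occupied. In the induction, \<open>v\<close> is a vertex of minimal \<open>g\<close>,
  hence not the parent of any other vertex.\<close>
lemma greedy_embedding:
  assumes "finite V" "R \<subseteq> V" "card V \<le> M"
    and par: "\<And>v. v \<in> V - R \<Longrightarrow> par v \<in> V" "\<And>v. v \<in> V - R \<Longrightarrow> (g v :: nat) < g (par v)"
    and base: "inj_on \<kappa> R" "\<And>w. w \<in> R \<Longrightarrow> \<kappa> w \<in> rich H n M (g w)"
  shows "\<exists>\<iota>. inj_on \<iota> V \<and> (\<forall>v\<in>V. \<iota> v \<in> rich H n M (g v)) \<and> (\<forall>w\<in>R. \<iota> w = \<kappa> w)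
           \<and> (\<forall>v\<in>V - R. arc H (\<iota> (par v)) (\<iota> v))"
  using assms(1-5)
proof (induction "card (V - R)" arbitrary: V)
  case 0
  then have "V = R" using finite_subset by auto
  then show ?case using base by (intro exI[of _ \<kappa>]) auto
next
  case (Suc m)
  have "V - R \<noteq> {}" using Suc.hyps(2) by (metis card.empty Zero_neq_Suc)
  then obtain v where v: "v \<in> V - R" "\<And>u. u \<in> V - R \<Longrightarrow> g v \<le> g u"
    using ex_has_least_nat[of "\<lambda>v. v \<in> V - R" _ g] by blast
  let ?W = "V - {v}"
  have W: "card (?W - R) = m" "card ?W < M"
  proof -
    have "?W - R = (V - R) - {v}" by blast
    then show "card (?W - R) = m" using Suc.hyps(2) v(1) by simp
    show "card ?W < M" using Suc.prems(1,3) v(1) by (meson DiffD1 card_Diff1_less order_less_le_trans)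
  qed
  have pW: "par u \<in> ?W" if "u \<in> V - R" for u
    using Suc.prems(4,5)[OF that] v(2)[OF that] by auto
  obtain \<iota> where \<iota>: "inj_on \<iota> ?W" "\<And>u. u \<in> ?W \<Longrightarrow> \<iota> u \<in> rich H n M (g u)"
    "\<And>w. w \<in> R \<Longrightarrow> \<iota> w = \<kappa> w" "\<And>u. u \<in> ?W - R \<Longrightarrow> arc H (\<iota> (par u)) (\<iota> u)"
    using Suc.hyps(1)[of ?W] W Suc.prems v(1) pW by force
  have "\<iota> (par v) \<in> rich H n M (Suc (g v))"
    using \<iota>(2)[OF pW[OF v(1)]] Suc.prems(5)[OF v(1)] rich_antimono[of "Suc (g v)" "g (par v)"] by auto
  then have big: "M \<le> card {y \<in> rich H n M (g v). arc H (\<iota> (par v)) y}" (is "_ \<le> card ?Y") by simp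
  have "card (\<iota> ` ?W) < M" using W(2) card_image[OF \<iota>(1)] by simp
  with big have "card (\<iota> ` ?W) < card ?Y" by simp
  then have "\<not> ?Y \<subseteq> \<iota> ` ?W" using Suc.prems(1) card_mono[of "\<iota> ` ?W" ?Y] by auto
  then obtain y where y: "y \<in> rich H n M (g v)" "arc H (\<iota> (par v)) y" "y \<notin> \<iota> ` ?W" by blast
  let ?\<iota> = "\<iota>(v := y)"
  have "inj_on ?\<iota> V" using \<iota>(1) y(3) by (auto simp: inj_on_def)
  moreover have "arc H (?\<iota> (par u)) (?\<iota> u)" if "u \<in> V - R" for u
    using \<iota>(4)[of u] y(2) pW[OF that] that by auto
  ultimately show ?case using \<iota>(2,3) y(1) v(1) by (intro exI[of _ ?\<iota>]) auto
qed

text \<open>A copy is determined by an injection of the vertices and a choice of one vector above each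
  edge; without isolated vertices the supports automatically cover the image of \<open>V\<close>.\<close>
lemma s_copyI:
  assumes VE: "\<And>e. e \<in> E \<Longrightarrow> e \<subseteq> V" "\<And>v. v \<in> V \<Longrightarrow> \<exists>e\<in>E. v \<in> e"
    and inj: "inj_on \<iota> V" and y: "\<And>e. e \<in> E \<Longrightarrow> y e \<in> H" "\<And>e. e \<in> E \<Longrightarrow> supp (y e) = \<iota> ` e"
    and sum: "\<And>e e' v. e \<in> E \<Longrightarrow> e' \<in> E \<Longrightarrow> e \<noteq> e' \<Longrightarrow> v \<in> e \<Longrightarrow> v \<in> e' \<Longrightarrow>
                y e (\<iota> v) + y e' (\<iota> v) \<ge> s"
  shows "contains_s_copy s V E H"
proof -
  have img: "\<iota> ` e = \<iota> ` e' \<longleftrightarrow> e = e'" if "e \<subseteq> V" "e' \<subseteq> V" for e e'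
    using inj_on_image_eq_iff[OF inj that] .
  have suppE: "supp ` y ` E = (`) \<iota> ` E" using y(2) by force
  have "card (y ` E) = card E"
    using VE(1) y(2) img by (intro card_image inj_onI) metis
  moreover have "graph_iso \<iota> V E (\<Union>x\<in>y ` E. supp x) (supp ` y ` E)"
  proof -
    have "\<iota> ` V = (\<Union>x\<in>y ` E. supp x)" using VE y(2) by fastforce
    moreover have "{u, v} \<in> E \<longleftrightarrow> {\<iota> u, \<iota> v} \<in> supp ` y ` E" if "u \<in> V" "v \<in> V" for u v
    proof
      assume "{\<iota> u, \<iota> v} \<in> supp ` y ` E"
      then obtain e where e: "e \<in> E" "\<iota> ` {u, v} = \<iota> ` e" unfolding suppE by auto
      with img[of "{u, v}" e] VE(1) that show "{u, v} \<in> E" by auto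
    qed (auto simp: suppE intro: image_eqI[of _ _ "{u, v}"])
    ultimately show ?thesis using inj by (auto simp: graph_iso_def bij_betw_def)
  qed
  moreover have "x (\<iota> v) + x' (\<iota> v) \<ge> s" if "e \<in> E" "e' \<in> E" "e \<noteq> e'" "v \<in> e \<inter> e'"
    "x \<in> y ` E" "x' \<in> y ` E" "supp x = \<iota> ` e" "supp x' = \<iota> ` e'" for e e' v x x'
  proof -
    have "x = y e" "x' = y e'" using that y(2) img VE(1) by (metis imageE)+
    with sum that show ?thesis by auto
  qed
  ultimately have "s_copy s V E (y ` E)" unfolding s_copy_def by blast
  with y(1) show ?thesis unfolding contains_s_copy_def by blast
qed

text \<open>The greedy embedding turns each edge \<open>{v, par v}\<close> into an arc out of the image of \<open>par v\<close>. Two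
  distinct edges at a vertex \<open>v\<close> cannot both be the edge to its parent or the root edge, so one of
  them has label \<open>2\<close> at \<open>v\<close>, and the labels add up to at least \<open>3\<close>. The labels of the vector
  on the root edge are arbitrary.\<close>
lemma rich_roots_give_copy:
  assumes tree: "is_tree V E" and EV: "\<Union> E = V" and R: "R \<subseteq> V" and ER: "ER \<subseteq> E" "\<Union> ER \<subseteq> R"
    and ER_one: "\<And>e e'. e \<in> ER \<Longrightarrow> e' \<in> ER \<Longrightarrow> e = e'"
    and ER_conn: "\<And>x y. x \<in> R \<Longrightarrow> y \<in> R \<Longrightarrow> (x, y) \<in> (adj ER)\<^sup>*"
    and near: "\<And>v. v \<in> V \<Longrightarrow> \<exists>w\<in>R. graph_dist E w v \<le> h"
    and \<kappa>: "inj_on \<kappa> R" "\<And>w. w \<in> R \<Longrightarrow> \<kappa> w \<in> rich H n (card V) h"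
    and root_edge: "\<And>e. e \<in> ER \<Longrightarrow> \<exists>x\<in>H. supp x = \<kappa> ` e"
  shows "contains_s_copy 3 V E H"
proof -
  have fin: "finite V" using tree by (auto simp: is_tree_def ugraph_def)
  obtain par g where
    p: "\<forall>v\<in>V - R. par v \<in> V \<and> (g v :: nat) < g (par v)" and gR: "\<forall>w\<in>R. g w = h" and E: "E = ER \<union> (\<lambda>v. {v, par v}) ` (V - R)"
    using tree_rooted_decomposition[OF tree R ER(1) ER_conn near] by metis
  from p have par: "\<And>v. v \<in> V - R \<Longrightarrow> par v \<in> V" "\<And>v. v \<in> V - R \<Longrightarrow> g v < g (par v)"
    by blast+
  obtain \<iota> where \<iota>: "inj_on \<iota> V" "\<And>w. w \<in> R \<Longrightarrow> \<iota> w = \<kappa> w"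
    "\<And>v. v \<in> V - R \<Longrightarrow> arc H (\<iota> (par v)) (\<iota> v)"
    using greedy_embedding[where par = par and g = g, OF fin R order_refl par \<kappa>(1), where H = H and n = n] \<kappa>(2) gR by metis
  have "\<exists>x\<in>H. supp x = \<iota> ` e \<and> (\<forall>v\<in>V - R. e = {v, par v} \<longrightarrow> x (\<iota> (par v)) = 2)"
    if e: "e \<in> E" for e
  proof (cases "e \<in> ER")
    case True
    have "\<iota> ` e = \<kappa> ` e" using True ER(2) \<iota>(2) by (intro image_cong) auto
    moreover have "e \<noteq> {v, par v}" if "v \<in> V - R" for v using True ER(2) that by auto
    ultimately show ?thesis using root_edge[OF True] by auto
  next
    case False
    with e E obtain v where v: "v \<in> V - R" "e = {v, par v}" by blast
    obtain x where x: "x \<in> H" "supp x = {\<iota> (par v), \<iota> v}" "x (\<iota> (par v)) = 2"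
      using \<iota>(3)[OF v(1)] unfolding arc_def by blast
    have uniq: "u = v" if u: "u \<in> V - R" "e = {u, par u}" for u
    proof (rule ccontr)
      assume "u \<noteq> v"
      moreover have "{u, par u} = {v, par v}" using u(2) v(2) by (rule subst)
      ultimately have "u = par v" "par u = v" unfolding doubleton_eq_iff by blast+
      then show False using par(2)[OF u(1)] par(2)[OF v(1)] by (metis less_asym)
    qed
    have "supp x = \<iota> ` e" unfolding x(2) v(2) by auto
    with x uniq show ?thesis by blast
  qed
  then have "\<exists>y. \<forall>e\<in>E. y e \<in> H \<and> supp (y e) = \<iota> ` e \<and>
      (\<forall>v\<in>V - R. e = {v, par v} \<longrightarrow> y e (\<iota> (par v)) = 2)"
    by (intro bchoice) blast
  then obtain y where yall: "\<forall>e\<in>E. y e \<in> H \<and> supp (y e) = \<iota> ` e \<and>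
      (\<forall>v\<in>V - R. e = {v, par v} \<longrightarrow> y e (\<iota> (par v)) = 2)" ..
  have y: "y e \<in> H" "supp (y e) = \<iota> ` e" if "e \<in> E" for e using yall that by simp_all
  have y2: "y e (\<iota> (par v)) = 2" if "e \<in> E" "v \<in> V - R" "e = {v, par v}" for e v
    using yall that by simp
  show ?thesis
  proof (rule s_copyI[OF _ _ \<iota>(1) y(1,2)])
    fix e e' v assume e: "e \<in> E" "e' \<in> E" "e \<noteq> e'" "v \<in> e" "v \<in> e'"
    have pos: "y f (\<iota> v) \<ge> 1" if "f \<in> E" "v \<in> f" for f
    proof -
      have "\<iota> v \<in> supp (y f)" using y(2)[OF that(1)] that(2) by simp
      then show ?thesis by (simp add: supp_def)
    qed
    have up: "(v \<in> R \<and> f \<in> ER) \<or> (v \<in> V - R \<and> f = {v, par v})"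
      if f: "f \<in> E" "v \<in> f" "y f (\<iota> v) \<noteq> 2" for f
    proof (cases "f \<in> ER")
      case True
      with ER(2) f(2) show ?thesis by blast
    next
      case False
      with f(1) E obtain u where u: "u \<in> V - R" "f = {u, par u}" by blast
      with y2[OF f(1) u] f have "v = u" by auto
      with u show ?thesis by simp
    qed
    have "y e (\<iota> v) = 2 \<or> y e' (\<iota> v) = 2"
      using up[of e] up[of e'] e ER_one by blast
    with pos[of e] pos[of e'] e show "3 \<le> y e (\<iota> v) + y e' (\<iota> v)" by auto
  qed (use EV in auto)
qed

section \<open>Counting the edges of a multipartite graph\<close>

lemma finite_multipartite_edges: "finite (multipartite_edges n c)"
  by (rule finite_subset[of _ "Pow {..<n}"]) (auto simp: multipartite_edges_def)

text \<open>Both sides count the ordered pairs of vertices, according to whether the colours differ.\<close>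
lemma card_multipartite_edges:
  assumes c: "\<And>i. i < n \<Longrightarrow> c i < r"
  shows "2 * card (multipartite_edges n c) + (\<Sum>k<r. (card {i. i < n \<and> c i = k})\<^sup>2) = n\<^sup>2"
proof -
  define up where "up = {(i, j). i < n \<and> j < n \<and> c i < c j}"
  define same where "same = {(i, j). i < n \<and> j < n \<and> c i = c j}"
  have fin: "finite up" "finite same"
    by (rule finite_subset[of _ "{..<n} \<times> {..<n}"]; auto simp: up_def same_def)+
  have "card up = card (multipartite_edges n c)"
  proof (rule bij_betw_same_card)
    show "bij_betw (\<lambda>(i, j). {i, j}) up (multipartite_edges n c)"
      unfolding bij_betw_def
    proof
      show "inj_on (\<lambda>(i, j). {i, j}) up" by (auto simp: inj_on_def up_def doubleton_eq_iff)
      show "(\<lambda>(i, j). {i, j}) ` up = multipartite_edges n c"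
      proof (intro equalityI subsetI)
        fix e assume "e \<in> multipartite_edges n c"
        then obtain i j where e: "e = {i, j}" "i < n" "j < n" "c i \<noteq> c j"
          by (auto simp: multipartite_edges_def)
        then consider "(i, j) \<in> up" | "(j, i) \<in> up" by (fastforce simp: up_def)
        then show "e \<in> (\<lambda>(i, j). {i, j}) ` up" by cases (force simp: e(1))+
      qed (fastforce simp: up_def multipartite_edges_def)
    qed
  qed
  moreover have "card (prod.swap ` up) = card up" by (rule card_image) simp
  moreover have "card same = (\<Sum>k<r. (card {i. i < n \<and> c i = k})\<^sup>2)"
  proof -
    have "same = (\<Union>k<r. {i. i < n \<and> c i = k} \<times> {i. i < n \<and> c i = k})"
      using c by (auto simp: same_def)
    also have "card \<dots> = (\<Sum>k<r. card ({i. i < n \<and> c i = k} \<times> {i. i < n \<and> c i = k}))"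
      by (rule card_UN_disjoint) auto
    finally show ?thesis by (simp add: card_cartesian_product power2_eq_square)
  qed
  moreover have "{..<n} \<times> {..<n} = up \<union> prod.swap ` up \<union> same"
    by (auto simp: up_def same_def image_iff)
  moreover have "card (up \<union> prod.swap ` up \<union> same) = card up + card (prod.swap ` up) + card same"
    using fin by (subst card_Un_disjoint, (auto simp: up_def same_def)[3],
        subst card_Un_disjoint, auto simp: up_def)
  ultimately show ?thesis
    by (metis card_cartesian_product card_lessThan mult_2 power2_eq_square)
qed

lemma sum_card_classes:
  fixes c :: "nat \<Rightarrow> nat"
  assumes c: "\<And>i. i < n \<Longrightarrow> c i < r"
  shows "(\<Sum>k<r. card {i. i < n \<and> c i = k}) = n"
proof -
  have "{..<n} = (\<Union>k<r. {i. i < n \<and> c i = k})" using c by auto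
  then have "n = card (\<Union>k<r. {i. i < n \<and> c i = k})" by (metis card_lessThan)
  also have "\<dots> = (\<Sum>k<r. card {i. i < n \<and> c i = k})" by (rule card_UN_disjoint) auto
  finally show ?thesis by simp
qed

definition pairs :: "'a set \<Rightarrow> 'a set set" where
  "pairs S = {e. e \<subseteq> S \<and> card e = 2}"

lemma card_pairs_diff:
  assumes "S \<subseteq> {..<n::nat}"
  shows "real (card (pairs {..<n} - pairs S)) = real (n choose 2) - real (card S choose 2)"
proof -
  have S: "finite S" using assms finite_subset by blast
  have sub: "pairs S \<subseteq> pairs {..<n}" using assms by (auto simp: pairs_def)
  have fin: "finite (pairs {..<n})" unfolding pairs_def by (rule finite_subset[of _ "Pow {..<n}"]) auto
  have "card (pairs S) = card S choose 2" "card (pairs {..<n}) = n choose 2"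
    using n_subsets[OF S, of 2] n_subsets[of "{..<n}" 2] by (simp_all add: pairs_def)
  then show ?thesis using card_Diff_subset[OF finite_subset[OF sub fin] sub] card_mono[OF fin sub]
    by simp
qed

lemma real_choose_two: "real (n choose 2) = (real n ^ 2 - real n) / 2"
proof -
  have "even (n * (n - 1))" by (cases n) simp_all
  then have "real (n choose 2) = real (n * (n - 1)) / 2"
    by (simp only: choose_two real_of_nat_div)  
  then show ?thesis by (cases n) (auto simp: power2_eq_square algebra_simps)
qed

section \<open>Two-labelled edges\<close>

definition vec :: "nat \<Rightarrow> nat \<Rightarrow> nat \<Rightarrow> nat \<Rightarrow> nat \<Rightarrow> nat" where
  "vec i a j b = (\<lambda>k. if k = i then a else if k = j then b else 0)"

lemma supp_vec: "a \<noteq> 0 \<Longrightarrow> b \<noteq> 0 \<Longrightarrow> supp (vec i a j b) = {i, j}"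
  by (auto simp: supp_def vec_def)

lemma vec_in_qedges:
  "\<lbrakk>i < n; j < n; i \<noteq> j; a \<in> {1..q}; b \<in> {1..q}\<rbrakk> \<Longrightarrow> vec i a j b \<in> qedges n q"
  by (auto simp: qedges_def supp_vec) (auto simp: qvectors_def vec_def)

lemma qedges_2_eq_vec:
  assumes x: "x \<in> qedges n 2" and s: "supp x = {i, j}"
  shows "i < n" "j < n" "i \<noteq> j" "x i \<in> {1, 2}" "x j \<in> {1, 2}" "x = vec i (x i) j (x j)"
proof -
  have q: "x \<in> qvectors n 2" and "card {i, j} = 2" using x s by (auto simp: qedges_def)
  then show "i \<noteq> j" by auto
  have mem: "x k \<noteq> 0 \<longleftrightarrow> k = i \<or> k = j" for k
  proof -
    have "k \<in> supp x \<longleftrightarrow> k = i \<or> k = j" using s by simp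
    then show ?thesis by (simp add: supp_def)
  qed
  have nz: "x i \<noteq> 0" "x j \<noteq> 0" using mem by simp_all
  have "x k = 0" if "k \<ge> n" for k using q that by (simp add: qvectors_def)
  with nz show ij: "i < n" "j < n" by (metis not_le)+
  then have "x i \<le> 2" "x j \<le> 2" using q by (auto simp: qvectors_def)
  with nz show "x i \<in> {1, 2}" "x j \<in> {1, 2}" by auto
  show "x = vec i (x i) j (x j)"
  proof
    show "x k = vec i (x i) j (x j) k" for k using mem[of k] by (auto simp: vec_def)
  qed
qed

lemma qedges_supp:
  assumes "x \<in> qedges n q"
  obtains i j where "supp x = {i, j}" "i \<noteq> j"
proof -
  have "card (supp x) = 2" using assms by (simp add: qedges_def)
  then show ?thesis using that by (auto simp: card_2_iff)
qed

lemma card_all_ones_le: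
  assumes H: "H \<subseteq> qedges n 2" and none: "\<And>x. x \<in> H \<Longrightarrow> \<not> supp x \<subseteq> S"
  shows "card {x \<in> H. \<forall>i\<in>supp x. x i = 1} \<le> card (pairs {..<n} - pairs S)"
proof (rule card_inj_on_le)
  show "inj_on supp {x \<in> H. \<forall>i\<in>supp x. x i = 1}"
  proof (rule inj_onI, rule ext)
    fix x y i assume "x \<in> {x \<in> H. \<forall>i\<in>supp x. x i = 1}" "y \<in> {x \<in> H. \<forall>i\<in>supp x. x i = 1}"
      and eq: "supp x = supp y"
    then have ones: "\<forall>i\<in>supp x. x i = 1 \<and> y i = 1" by auto
    show "x i = y i"
    proof (cases "i \<in> supp x")
      case False
      with eq have "i \<notin> supp x" "i \<notin> supp y" by simp_all
      then have "x i = 0" "y i = 0" by (simp_all add: supp_def)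
      then show ?thesis by simp
    qed (use ones in simp)
  qed
  show "supp ` {x \<in> H. \<forall>i\<in>supp x. x i = 1} \<subseteq> pairs {..<n} - pairs S"
  proof
    fix e assume "e \<in> supp ` {x \<in> H. \<forall>i\<in>supp x. x i = 1}"
    then obtain x where x: "x \<in> H" "e = supp x" by blast
    then have q: "x \<in> qedges n 2" using H by blast
    then obtain i j where s: "supp x = {i, j}" by (rule qedges_supp)
    show "e \<in> pairs {..<n} - pairs S"
      using x none[OF x(1)] qedges_2_eq_vec(1-3)[OF q s] s by (auto simp: pairs_def)
  qed
  show "finite (pairs {..<n} - pairs S)"
    unfolding pairs_def by (rule finite_subset[of _ "Pow {..<n}"]) auto
qed

text \<open>Each vector that is not constantly \<open>1\<close> on its support has an arc. If one of its arcs fails to decrease the colour, it is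
  among at most \<open>2 * (n * M)\<close> vectors, namely two choices for the second label of each such arc.
  Otherwise it has label \<open>2\<close> only at the end of higher colour (a vector \<open>(2, 2)\<close> would also
  have an arc in the increasing direction), so it is determined by its support, which is an edge
  of the multipartite graph.\<close>
lemma card_le_by_colouring:
  assumes H: "H \<subseteq> qedges n 2"
    and few: "\<And>u. u < n \<Longrightarrow> card {v. v < n \<and> arc H u v \<and> c u \<le> c v} \<le> M"
  shows "card H \<le> card {x \<in> H. \<forall>i\<in>supp x. x i = 1} + card (multipartite_edges n c) + 2 * (n * M)"
proof -
  have finH: "finite H" using H finite_qedges finite_subset by blast
  define ones where "ones = {x \<in> H. \<forall>i\<in>supp x. x i = 1}"
  define bad where "bad = {x \<in> H. \<exists>u v. u \<noteq> v \<and> supp x = {u, v} \<and> x u = 2 \<and> c u \<le> c v}"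
  define P where "P = (SIGMA u:{..<n}. {v. v < n \<and> arc H u v \<and> c u \<le> c v})"
  have "card bad \<le> 2 * (n * M)"
  proof -
    have "bad \<subseteq> (\<lambda>((u, v), b). vec u 2 v b) ` (P \<times> {1, 2})"
    proof
      fix x assume "x \<in> bad"
      then obtain u v where x: "x \<in> H" "u \<noteq> v" "supp x = {u, v}" "x u = 2" "c u \<le> c v"
        by (auto simp: bad_def)
      then have q: "x \<in> qedges n 2" using H by blast
      have "arc H u v" unfolding arc_def using x by blast
      then have "(u, v) \<in> P" using qedges_2_eq_vec(1,2)[OF q x(3)] x(5) by (simp add: P_def)
      moreover have "x = vec u 2 v (x v)" "x v \<in> {1, 2}" using qedges_2_eq_vec[OF q x(3)] x(4) by simp_all
      ultimately show "x \<in> (\<lambda>((u, v), b). vec u 2 v b) ` (P \<times> {1, 2})"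
        by (intro image_eqI[of _ _ "((u, v), x v)"]) simp_all
    qed
    moreover have finP: "finite P" by (simp add: P_def)
    ultimately have "card bad \<le> card (P \<times> {1::nat, 2})"
      by (intro surj_card_le[where f = "\<lambda>((u, v), b). vec u 2 v b"]) simp_all
    also have "\<dots> = 2 * card P" by (simp add: card_cartesian_product)
    also have "card P = (\<Sum>u<n. card {v. v < n \<and> arc H u v \<and> c u \<le> c v})" by (simp add: P_def)
    also have "\<dots> \<le> n * M" using sum_bounded_above[of "{..<n}" _ M] few by simp
    finally show ?thesis by simp
  qed
  moreover have "card (H - ones - bad) \<le> card (multipartite_edges n c)"
  proof (rule card_inj_on_le[OF _ _ finite_multipartite_edges])
    have form: "\<exists>i j. i < n \<and> j < n \<and> c j < c i \<and> x = vec i 2 j 1" if x: "x \<in> H - ones - bad" for x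
    proof -
      have xH: "x \<in> H" using x by simp
      with H have q: "x \<in> qedges n 2" by blast
      obtain i where i: "i \<in> supp x" "x i \<noteq> 1" using x by (auto simp: ones_def)
      obtain j where s: "supp x = {i, j}" using qedges_supp[OF q] i(1) by (metis insertE insert_commute singletonD)
      note v = qedges_2_eq_vec[OF q s]
      have i2: "x i = 2" using i v by simp
      have nb: "\<not> c i \<le> c j" using x v(3) s i2 by (auto simp: bad_def)
      have "x j \<noteq> 2"
      proof
        assume "x j = 2"
        have "supp x = {j, i}" using s by (simp add: insert_commute)
        moreover have "c j \<le> c i" using nb by simp
        ultimately have "\<exists>u v. u \<noteq> v \<and> supp x = {u, v} \<and> x u = 2 \<and> c u \<le> c v"
          using v(3)[symmetric] \<open>x j = 2\<close> by (intro exI[of _ j] exI[of _ i] conjI)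
        with xH have "x \<in> bad" unfolding bad_def mem_Collect_eq by (rule conjI)
        with x show False by simp
      qed
      then have "x j = 1" using v(5) by simp
      with v i2 nb show ?thesis by (metis not_le)
    qed
    show "inj_on supp (H - ones - bad)"
    proof (rule inj_onI)
      fix x y assume "x \<in> H - ones - bad" "y \<in> H - ones - bad" and eq: "supp x = supp y"
      then obtain i j i' j' where x: "x = vec i 2 j 1" "c j < c i" and y: "y = vec i' 2 j' 1" "c j' < c i'"
        using form by metis
      then have "{i, j} = {i', j'}" using eq by (simp add: supp_vec)
      with x y have "i = i' \<and> j = j'" by (auto simp: doubleton_eq_iff)
      with x y show "x = y" by simp
    qed
    show "supp ` (H - ones - bad) \<subseteq> multipartite_edges n c"
    proof
      fix e assume "e \<in> supp ` (H - ones - bad)"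
      then obtain x where x: "x \<in> H - ones - bad" "e = supp x" by blast
      obtain i j where "i < n" "j < n" "c j < c i" "x = vec i 2 j 1" using form[OF x(1)] by blast
      with x(2) show "e \<in> multipartite_edges n c"
        unfolding multipartite_edges_def by (auto simp: supp_vec)
    qed
  qed
  moreover have "card H \<le> card ones + card (H - ones - bad) + card bad"
  proof -
    have fin: "finite ones" "finite (H - ones - bad)" "finite bad"
      using finH by (simp_all add: ones_def bad_def)
    have "card H \<le> card (ones \<union> (H - ones - bad) \<union> bad)"
      using fin by (intro card_mono) auto
    also have "\<dots> \<le> card ones + card (H - ones - bad) + card bad"
      using card_Un_le[of "ones \<union> (H - ones - bad)" bad] card_Un_le[of ones "H - ones - bad"] by linarith
    finally show ?thesis .
  qed
  ultimately show ?thesis by (simp add: ones_def)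
qed

section \<open>The extremal part sizes\<close>

text \<open>This is the Cauchy--Schwarz inequality for weights \<open>1\<close>, and \<open>1 + \<delta>\<close> at \<open>s\<close>, in tangent form:
  \<open>w * x\<^sup>2 \<ge> 2 * t * x - t\<^sup>2 / w\<close> for every \<open>t\<close>. The reciprocals of the weights
  add up to \<open>(2 * r - \<delta>) / 2\<close>, and the optimal \<open>t\<close> is \<open>n\<close> divided by this number. The parameter \<open>\<delta>\<close>
  stands for \<open>2 * r\<close> minus the diameter; for \<open>\<delta> = 1\<close> the class \<open>s\<close> has double weight because it
  loses the constant \<open>1\<close> vectors inside it.\<close>
lemma weighted_sum_of_squares_ge:
  fixes a :: "nat \<Rightarrow> real" and \<delta> :: nat
  assumes r: "s < r" and \<delta>: "\<delta> \<le> 1" and n: "(\<Sum>k<r. a k) = n"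
  shows "(\<Sum>k<r. (a k)\<^sup>2) + \<delta> * (a s)\<^sup>2 \<ge> 2 * n\<^sup>2 / real (2 * r - \<delta>)"
proof -
  define D where "D = real (2 * r - \<delta>)"
  define t where "t = 2 * n / D"
  have D: "D > 0" "D = 2 * real r - real \<delta>" using r \<delta> by (auto simp: D_def of_nat_diff)
  have "(\<Sum>k<r. 2 * t * a k - t\<^sup>2 * (if k = s then 1 - \<delta> / 2 else 1))
      \<le> (\<Sum>k<r. (a k)\<^sup>2 + (if k = s then \<delta> * (a s)\<^sup>2 else 0))"
  proof (rule sum_mono)
    fix k
    have "0 \<le> (a k - t)\<^sup>2" "0 \<le> (2 * a k - t)\<^sup>2" by simp_all
    moreover have "\<delta> = 0 \<or> \<delta> = 1" using \<delta> by auto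
    ultimately show "2 * t * a k - t\<^sup>2 * (if k = s then 1 - \<delta> / 2 else 1)
        \<le> (a k)\<^sup>2 + (if k = s then \<delta> * (a s)\<^sup>2 else 0)"
      by (auto simp: power2_eq_square algebra_simps)
  qed
  also have "\<dots> = (\<Sum>k<r. (a k)\<^sup>2) + \<delta> * (a s)\<^sup>2" using r by (simp add: sum.distrib)
  finally have le: "(\<Sum>k<r. 2 * t * a k - t\<^sup>2 * (if k = s then 1 - \<delta> / 2 else 1))
      \<le> (\<Sum>k<r. (a k)\<^sup>2) + \<delta> * (a s)\<^sup>2" .
  have "(\<Sum>k<r. (if k = s then 1 - \<delta> / 2 else 1 :: real)) = (\<Sum>k<r. 1 - (if k = s then \<delta> / 2 else 0))"
    by (rule sum.cong) auto
  also have "\<dots> = D / 2" using r D by (simp add: sum_subtractf)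
  finally have "(\<Sum>k<r. 2 * t * a k - t\<^sup>2 * (if k = s then 1 - \<delta> / 2 else 1)) = 2 * t * n - t\<^sup>2 * (D / 2)"
    by (simp add: sum_subtractf flip: sum_distrib_left n)
  also have "\<dots> = 2 * n\<^sup>2 / D" using D(1) by (simp add: t_def field_simps power2_eq_square)
  finally show ?thesis using le by (simp add: D_def)
qed

text \<open>Conversely, if every part has nearly the size at which the inequality above is an equality, that
  is \<open>t\<close> divided by its weight, then the weighted sum of squares is minimal up to a linear error.\<close>
lemma weighted_sum_of_squares_le:
  fixes a :: "nat \<Rightarrow> nat" and \<delta> :: nat
  assumes r: "s < r" and \<delta>: "\<delta> \<le> 1" and n: "(\<Sum>k<r. a k) = n"
    and a: "\<And>k. k < r \<Longrightarrow> real (a k) \<le> 2 * real n / real (2 * r - \<delta>) + 2"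
      "(1 + \<delta>) * real (a s) \<le> 2 * real n / real (2 * r - \<delta>) + 2"
  shows "(\<Sum>k<r. (real (a k))\<^sup>2) + \<delta> * (real (a s))\<^sup>2 \<le> 2 * (real n)\<^sup>2 / real (2 * r - \<delta>) + 2 * real n"
proof -
  define t where "t = 2 * real n / real (2 * r - \<delta>) + 2"
  have "(\<Sum>k<r. (real (a k))\<^sup>2) + \<delta> * (real (a s))\<^sup>2
      = (\<Sum>k<r. (real (a k))\<^sup>2 + (if k = s then \<delta> * (real (a s))\<^sup>2 else 0))"
    using r by (simp add: sum.distrib)
  also have "\<dots> \<le> (\<Sum>k<r. t * real (a k))"
  proof (rule sum_mono)
    fix k assume "k \<in> {..<r}"
    then have "(1 + (if k = s then real \<delta> else 0)) * real (a k) \<le> t" using a unfolding t_def by auto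
    from mult_right_mono[OF this, of "real (a k)"]
    show "(real (a k))\<^sup>2 + (if k = s then \<delta> * (real (a s))\<^sup>2 else 0) \<le> t * real (a k)"
      by (auto simp: power2_eq_square algebra_simps split: if_splits)
  qed
  also have "\<dots> = t * n" by (simp flip: sum_distrib_left n)
  also have "\<dots> = 2 * (real n)\<^sup>2 / real (2 * r - \<delta>) + 2 * real n"
    by (simp add: t_def power2_eq_square algebra_simps)
  finally show ?thesis .
qed

section \<open>The layered construction\<close>

text \<open>The set \<open>S\<close> will be the class of colour \<open>0\<close> for diameter \<open>2 * r - 1\<close>, and empty for diameter
  \<open>2 * r\<close>.\<close>
definition layered :: "nat \<Rightarrow> (nat \<Rightarrow> nat) \<Rightarrow> nat set \<Rightarrow> (nat \<Rightarrow> nat) set" where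
  "layered n c S = {vec i 1 j 1 | i j. i < n \<and> j < n \<and> i \<noteq> j \<and> \<not> (i \<in> S \<and> j \<in> S)}
                 \<union> {vec i 2 j 1 | i j. i < n \<and> j < n \<and> c i < c j}"

lemma layered_subset_qedges: "layered n c S \<subseteq> qedges n 2"
proof
  fix x assume "x \<in> layered n c S"
  then obtain i j a where "x = vec i a j 1" "i < n" "j < n" "i \<noteq> j" "a = 1 \<or> a = 2"
    unfolding layered_def by auto
  then show "x \<in> qedges n 2" using vec_in_qedges[of i n j a 2 1] by auto
qed

lemma card_layered_ge:
  "card (pairs {..<n} - pairs S) + card (multipartite_edges n c) \<le> card (layered n c S)"
proof -
  let ?A = "{vec i 1 j 1 | i j. i < n \<and> j < n \<and> i \<noteq> j \<and> \<not> (i \<in> S \<and> j \<in> S)}"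
  let ?B = "{vec i 2 j 1 | i j. i < n \<and> j < n \<and> c i < c j}"
  have fin: "finite ?A" "finite ?B"
    using finite_subset[OF layered_subset_qedges finite_qedges, of n c S] by (simp_all add: layered_def)
  have "pairs {..<n} - pairs S \<subseteq> supp ` ?A"
  proof
    fix e assume e: "e \<in> pairs {..<n} - pairs S"
    then obtain i j where ij: "e = {i, j}" "i \<noteq> j" by (auto simp: pairs_def card_2_iff)
    with e have "vec i 1 j 1 \<in> ?A" by (auto simp: pairs_def)
    moreover have "e = supp (vec i 1 j 1)" using ij by (simp add: supp_vec)
    ultimately show "e \<in> supp ` ?A" by (simp only: imageI)
  qed
  moreover have "multipartite_edges n c \<subseteq> supp ` ?B"
  proof
    fix e assume "e \<in> multipartite_edges n c"
    then obtain i j where ij: "e = {i, j}" "i < n" "j < n" "c i < c j"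
      unfolding multipartite_edges_def by (smt (verit) insert_commute linorder_neqE_nat mem_Collect_eq)
    then have "vec i 2 j 1 \<in> ?B" by blast
    moreover have "e = supp (vec i 2 j 1)" using ij by (simp add: supp_vec)
    ultimately show "e \<in> supp ` ?B" by (simp only: imageI)
  qed
  ultimately have "card (pairs {..<n} - pairs S) \<le> card ?A" "card (multipartite_edges n c) \<le> card ?B"
    using fin by (simp_all add: surj_card_le)
  moreover have "?A \<inter> ?B = {}"
  proof -
    have False if "vec i 1 j 1 = vec k 2 l 1" for i j k l :: nat
    proof -
      have "vec i 1 j 1 k = vec k 2 l 1 k" using that by simp
      then show False by (simp add: vec_def split: if_splits)
    qed
    then show ?thesis by blast
  qed
  ultimately show ?thesis using fin by (simp add: layered_def card_Un_disjoint)
qed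

lemma layered_cases:
  assumes x: "x \<in> layered n c S" and s: "supp x = {u, v}"
  obtains "x u = 1" "x v = 1" "\<not> (u \<in> S \<and> v \<in> S)" "u < n" "v < n"
    | "x u = 2" "x v = 1" "c u < c v" "u < n" "v < n"
    | "x u = 1" "x v = 2" "c v < c u" "u < n" "v < n"
proof -
  consider (ones) i j where "x = vec i 1 j 1" "i < n" "j < n" "i \<noteq> j" "\<not> (i \<in> S \<and> j \<in> S)"
    | (arcs) i j where "x = vec i 2 j 1" "i < n" "j < n" "c i < c j"
    using x unfolding layered_def by blast
  then show ?thesis
  proof cases
    case ones
    then have "{i, j} = {u, v}" using s by (simp add: supp_vec)
    then have "(i = u \<and> j = v) \<or> (i = v \<and> j = u)" by (simp add: doubleton_eq_iff)
    then show ?thesis using ones that(1) by (auto simp: vec_def)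
  next
    case arcs
    then have "{i, j} = {u, v}" using s by (simp add: supp_vec)
    then have "(i = u \<and> j = v) \<or> (i = v \<and> j = u)" by (simp add: doubleton_eq_iff)
    then show ?thesis
    proof
      assume "i = u \<and> j = v"
      with arcs show ?thesis by (intro that(2)) (auto simp: vec_def)
    next
      assume "i = v \<and> j = u"
      with arcs show ?thesis by (intro that(3)) (auto simp: vec_def)
    qed
  qed
qed

text \<open>Here \<open>l i\<close> and \<open>m i\<close> are the labels of the \<open>i\<close>-th edge of a path at its two ends, and \<open>f i\<close> is the
  colour of the \<open>i\<close>-th vertex. Let \<open>i\<close> be the first edge with \<open>m i = 1\<close>. All earlier edges are
  arcs pointing backward, and all later ones are arcs pointing forward, as label \<open>1\<close> at the end of an
  edge forces label \<open>2\<close> at the beginning of the next. Hence \<open>f i + i\<close> and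
  \<open>f (Suc i) + (d - Suc i)\<close> are both less than \<open>r\<close>. Without such an edge, \<open>d\<close> itself is less than
  \<open>r\<close>.\<close>
lemma labelled_path_in_layers:
  fixes l m f :: "nat \<Rightarrow> nat"
  assumes step: "\<And>i. i < d \<Longrightarrow> (l i = 1 \<and> m i = 1) \<or> (l i = 2 \<and> m i = 1 \<and> f i < f (Suc i))
                   \<or> (l i = 1 \<and> m i = 2 \<and> f (Suc i) < f i)"
    and sum: "\<And>i. Suc i < d \<Longrightarrow> m i + l (Suc i) \<ge> 3"
    and f: "\<And>i. i \<le> d \<Longrightarrow> f i < r" and d: "d \<ge> 2 * r - 1"
  shows "d = 2 * r - 1 \<and> (\<exists>i<d. l i = 1 \<and> m i = 1 \<and> f i = 0 \<and> f (Suc i) = 0)"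
proof -
  have r: "r \<ge> 1" using f[of 0] by simp
  have down: "f i + i \<le> f 0" if "i \<le> d" "\<And>j. j < i \<Longrightarrow> m j \<noteq> 1" for i
    using that
  proof (induction i)
    case (Suc i)
    then have "f i + i \<le> f 0" by simp
    moreover have "f (Suc i) < f i" using step[of i] Suc.prems(1) Suc.prems(2)[of i] by auto
    ultimately show ?case by simp
  qed simp
  show ?thesis
  proof (cases "\<exists>i<d. m i = 1")
    case False
    with down[of d] f[of 0] d r show ?thesis by auto
  next
    case True
    define i where "i = (LEAST i. i < d \<and> m i = 1)"
    have i: "i < d" "m i = 1" using LeastI_ex[OF True] by (simp_all add: i_def)
    have "m j \<noteq> 1" if "j < i" for j using not_less_Least[of j "\<lambda>i. i < d \<and> m i = 1"] that i
      unfolding i_def[symmetric] by auto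
    then have left: "f i + i \<le> f 0" using down i by simp
    have "f (Suc i) + k \<le> f (Suc i + k) \<and> (Suc i + k \<le> d \<longrightarrow> m (i + k) = 1)" if "Suc i + k \<le> d" for k
      using that
    proof (induction k)
      case (Suc k)
      then have IH: "f (Suc i) + k \<le> f (Suc i + k)" "m (i + k) = 1" by simp_all
      have "l (Suc (i + k)) \<ge> 2" using sum[of "i + k"] IH(2) Suc.prems by simp
      with step[of "Suc (i + k)"] Suc.prems
      have "m (Suc (i + k)) = 1" "f (Suc (i + k)) < f (Suc (Suc (i + k)))" by auto
      with IH show ?case by simp
    qed (use i in simp)
    from this[of "d - Suc i"] i(1) have right: "f (Suc i) + (d - Suc i) \<le> f d" by simp
    have "f i + f (Suc i) + (d - 1) \<le> 2 * (r - 1)"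
      using left right f[of 0] f[of d] i(1) by simp
    with d r have z: "d = 2 * r - 1" "f i = 0" "f (Suc i) = 0" by linarith+
    with step[OF i(1)] i show ?thesis by auto
  qed
qed

text \<open>Apply the preceding lemma to the image of a diametral path of the tree.\<close>
lemma layered_no_copy:
  assumes tree: "is_tree V E" and c: "\<And>i. i < n \<Longrightarrow> c i < r"
    and diam: "diameter V E = 2 * r \<or> diameter V E = 2 * r - 1 \<and> {i. i < n \<and> c i = 0} \<subseteq> S"
    and r: "r \<ge> 1"
  shows "\<not> contains_s_copy 3 V E (layered n c S)"
proof
  assume "contains_s_copy 3 V E (layered n c S)"
  then obtain H \<iota> where H: "H \<subseteq> layered n c S"
    and iso: "graph_iso \<iota> V E (\<Union>x\<in>H. supp x) (supp ` H)"
    and sum: "\<And>e e' v x x'. \<lbrakk>e \<in> E; e' \<in> E; e \<noteq> e'; v \<in> e \<inter> e'; x \<in> H; x' \<in> H;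
       supp x = \<iota> ` e; supp x' = \<iota> ` e'\<rbrakk> \<Longrightarrow> x (\<iota> v) + x' (\<iota> v) \<ge> 3"
    unfolding contains_s_copy_def s_copy_def by meson
  have fin: "finite V" and ne: "V \<noteq> {}" and E2: "\<And>e. e \<in> E \<Longrightarrow> e \<subseteq> V"
    and conn: "\<And>u v. u \<in> V \<Longrightarrow> v \<in> V \<Longrightarrow> (u, v) \<in> (adj E)\<^sup>*"
    using tree by (auto simp: is_tree_def ugraph_def connected_graph_def)
  define d where "d = diameter V E"
  obtain u v where uv: "u \<in> V" "v \<in> V" "graph_dist E u v = d"
    using diameter_attained[OF fin ne, of E] unfolding d_def by metis
  obtain p where p: "geodesic E p d"
    using geodesic_exists[OF conn[OF uv(1,2)]] uv(3) by metis
  have edge: "{p i, p (Suc i)} \<in> E" if "i < d" for i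
    using p that by (auto simp: geodesic_def adj_def)
  have "\<exists>x\<in>H. supp x = {\<iota> (p i), \<iota> (p (Suc i))}" if "i < d" for i
  proof -
    have "{\<iota> (p i), \<iota> (p (Suc i))} \<in> supp ` H"
      using iso edge[OF that] E2[OF edge[OF that]] by (simp add: graph_iso_def)
    then show ?thesis by (metis imageE)
  qed
  then obtain x where xH: "\<And>i. i < d \<Longrightarrow> x i \<in> H"
    and x: "\<And>i. i < d \<Longrightarrow> supp (x i) = {\<iota> (p i), \<iota> (p (Suc i))}" by metis
  define l where "l i = x i (\<iota> (p i))" for i
  define m where "m i = x i (\<iota> (p (Suc i)))" for i
  define f where "f i = c (\<iota> (p i))" for i
  have labels: "\<iota> (p i) < n \<and> \<iota> (p (Suc i)) < n \<and>
      (l i = 1 \<and> m i = 1 \<and> \<not> (\<iota> (p i) \<in> S \<and> \<iota> (p (Suc i)) \<in> S) \<or> l i = 2 \<and> m i = 1 \<and> f i < f (Suc i)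
        \<or> l i = 1 \<and> m i = 2 \<and> f (Suc i) < f i)" if "i < d" for i
  proof -
    have xl: "x i \<in> layered n c S" using xH[OF that] H by blast
    show ?thesis
      by (rule layered_cases[OF xl x[OF that]]) (simp_all add: l_def m_def f_def)
  qed
  have three: "m i + l (Suc i) \<ge> 3" if "Suc i < d" for i
  proof -
    have "p i \<noteq> p (Suc (Suc i))" using inj_onD[OF geodesic_inj[OF p], of i "Suc (Suc i)"] that by auto
    then have "{p i, p (Suc i)} \<noteq> {p (Suc i), p (Suc (Suc i))}" by (auto simp: doubleton_eq_iff)
    from sum[OF edge edge this, of "p (Suc i)" "x i" "x (Suc i)"] that xH x
    show ?thesis by (simp add: l_def m_def)
  qed
  have "f i < r" if "i \<le> d" for i
  proof -
    have "d \<ge> 1" using diam r by (auto simp: d_def)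
    then have "i < d \<or> (i = Suc (d - 1) \<and> d - 1 < d)" using that by auto
    then have "\<iota> (p i) < n" using labels by metis
    then show ?thesis using c by (simp add: f_def)
  qed
  then have "d = 2 * r - 1 \<and> (\<exists>i<d. l i = 1 \<and> m i = 1 \<and> f i = 0 \<and> f (Suc i) = 0)"
    using diam r labels three by (intro labelled_path_in_layers) (auto simp: d_def)
  then obtain i where i: "d = 2 * r - 1" "i < d" "l i = 1" "m i = 1" "f i = 0" "f (Suc i) = 0" by blast
  have "{i. i < n \<and> c i = 0} \<subseteq> S" using diam i(1) r by (auto simp: d_def)
  with labels[OF i(2)] i show False by (auto simp: f_def)
qed

section \<open>Hosts without a copy\<close>

lemma tree_Union_edges:
  assumes tree: "is_tree V E" and r: "radius V E \<ge> 1"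
  shows "\<Union> E = V"
proof
  show "\<Union> E \<subseteq> V" using tree by (auto simp: is_tree_def ugraph_def)
  show "V \<subseteq> \<Union> E"
  proof
    fix v assume v: "v \<in> V"
    have "\<exists>u\<in>V. u \<noteq> v"
    proof (rule ccontr)
      assume "\<not> ?thesis"
      with v have "V = {v}" by blast
      moreover have "graph_dist E v v = 0" using graph_dist_le[where k = 0 and u = v and v = v and E = E] by simp
      ultimately show False using r by (simp add: radius_def)
    qed
    then obtain u where u: "u \<in> V" "u \<noteq> v" by blast
    then have "(v, u) \<in> (adj E)\<^sup>*" using tree v by (simp add: is_tree_def connected_graph_def)
    with u obtain y where "(v, y) \<in> adj E" by (metis converse_rtranclE)
    then show "v \<in> \<Union> E" by (auto simp: adj_def)
  qed
qed

text \<open>The tree has depth \<open>r\<close> when rooted at a vertex of minimal eccentricity.\<close>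
lemma no_copy_imp_not_rich:
  assumes tree: "is_tree V E" and r: "radius V E = r" "r \<ge> 1"
    and free: "\<not> contains_s_copy 3 V E H"
  shows "rich H n (card V) r = {}"
proof (rule ccontr)
  assume "\<not> ?thesis"
  then obtain u where u: "u \<in> rich H n (card V) r" by blast
  have "finite V" "V \<noteq> {}" using tree by (auto simp: is_tree_def ugraph_def connected_graph_def)
  then obtain w where w: "w \<in> V" "\<And>v. v \<in> V \<Longrightarrow> graph_dist E w v \<le> r"
    using radius_attained[of V E] r(1) by metis
  have "contains_s_copy 3 V E H"
    by (rule rich_roots_give_copy[OF tree tree_Union_edges[OF tree], of "{w}" "{}" r "\<lambda>_. u" H n])
      (use w u r in auto)
  with free show False ..
qed

text \<open>The two halves of the tree left by its central edge have depth \<open>r - 1\<close>, so that a vector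
  between two vertices rich of order \<open>r - 1\<close> could carry the central edge.\<close>
lemma no_copy_imp_no_edge_in_rich:
  assumes tree: "is_tree V E" and r: "radius V E = r" "r \<ge> 1" and diam: "diameter V E = 2 * r - 1"
    and free: "\<not> contains_s_copy 3 V E H" and H: "H \<subseteq> qedges n 2" "x \<in> H"
  shows "\<not> supp x \<subseteq> rich H n (card V) (r - 1)"
proof
  assume sub: "supp x \<subseteq> rich H n (card V) (r - 1)"
  obtain u v where uv: "supp x = {u, v}" "u \<noteq> v" using qedges_supp H by blast
  obtain a b where ab: "{a, b} \<in> E" "a \<in> V" "b \<in> V" "a \<noteq> b"
    and near: "\<forall>v\<in>V. graph_dist E a v \<le> r - 1 \<or> graph_dist E b v \<le> r - 1"
    by (rule tree_central_edge[OF tree diam r(2)])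
  have "contains_s_copy 3 V E H"
  proof (rule rich_roots_give_copy[OF tree tree_Union_edges[OF tree], of "{a, b}" "{{a, b}}" "r - 1"
        "\<lambda>z. if z = a then u else v" H n])
    have "(a, b) \<in> adj {{a, b}}" "(b, a) \<in> adj {{a, b}}" by (auto simp: adj_def)
    then show "(y, z) \<in> (adj {{a, b}})\<^sup>*" if "y \<in> {a, b}" "z \<in> {a, b}" for y z
      using that by auto
    show "\<exists>x\<in>H. supp x = (\<lambda>z. if z = a then u else v) ` e" if "e \<in> {{a, b}}" for e
      using that H(2) uv ab(4) by (intro bexI[of _ x]) auto
    show "inj_on (\<lambda>z. if z = a then u else v) {a, b}" using uv by (auto simp: inj_on_def)
    show "(if w = a then u else v) \<in> rich H n (card V) (r - 1)" for w using sub uv by simp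
  qed (use ab r near in auto)
  with free show False ..
qed

lemma card_le_of_no_copy:
  assumes tree: "is_tree V E" and r: "radius V E = r" "r \<ge> 1"
    and \<delta>: "\<delta> \<le> 1" "diameter V E = 2 * r - \<delta>"
    and free: "\<not> contains_s_copy 3 V E H" and H: "H \<subseteq> qedges n 2"
  shows "real (card H) \<le> (real n)\<^sup>2 - (real n)\<^sup>2 / real (2 * r - \<delta>) + (1 + 2 * real (card V)) * real n"
proof -
  let ?rich = "rich H n (card V)"
  have top: "?rich r = {}" using no_copy_imp_not_rich[OF tree r free] .
  \<comment> \<open>The largest order of richness of \<open>v\<close>, as the sets \<open>?rich k\<close> decrease with \<open>k\<close>.\<close>
  define c where "c v = (LEAST k. v \<notin> ?rich (Suc k))" for v
  have c_less: "c v < r" for v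
  proof -
    have "c v \<le> r - 1" unfolding c_def by (rule Least_le) (use top r in simp)
    with r show ?thesis by simp
  qed
  have c_rich: "v \<in> ?rich k" if "v < n" "k \<le> c v" for v k
  proof (cases k)
    case (Suc j)
    with that have "j < c v" by simp
    then show ?thesis unfolding c_def Suc by (metis not_less_Least)
  qed (use that in simp)
  have c_not: "v \<notin> ?rich (Suc (c v))" for v
    unfolding c_def by (rule LeastI[of "\<lambda>k. v \<notin> ?rich (Suc k)" "r - 1"]) (use top r in simp)
  have few: "card {v. v < n \<and> arc H u v \<and> c u \<le> c v} \<le> card V" if "u < n" for u
  proof -
    have "{v. v < n \<and> arc H u v \<and> c u \<le> c v} \<subseteq> {v \<in> ?rich (c u). arc H u v}" using c_rich by auto
    then have "card {v. v < n \<and> arc H u v \<and> c u \<le> c v} \<le> card {v \<in> ?rich (c u). arc H u v}"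
      by (intro card_mono) (simp_all add: finite_rich)
    also have "\<dots> < card V" using c_not[of u] that by simp
    finally show ?thesis by simp
  qed
  define a where "a k = card {i. i < n \<and> c i = k}" for k
  \<comment> \<open>For diameter \<open>2 * r - 1\<close>, the top colour class spans no vector of \<open>H\<close>.\<close>
  define S where "S = (if \<delta> = 1 then {i. i < n \<and> c i = r - 1} else {})"
  have S: "S \<subseteq> {..<n}" by (auto simp: S_def)
  have "\<not> supp x \<subseteq> S" if x: "x \<in> H" for x
  proof (cases "\<delta> = 1")
    case True
    then have "S \<subseteq> ?rich (r - 1)" using c_rich by (auto simp: S_def)
    then show ?thesis using no_copy_imp_no_edge_in_rich[OF tree r _ free H x] \<delta> True by auto
  next
    case False
    obtain i j where "supp x = {i, j}" by (rule qedges_supp[OF subsetD[OF H x]])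
    moreover have "S = {}" using False by (simp add: S_def)
    ultimately show ?thesis by simp
  qed
  then have ones: "card {x \<in> H. \<forall>i\<in>supp x. x i = 1} \<le> card (pairs {..<n} - pairs S)"
    by (rule card_all_ones_le[OF H])
  have "card H \<le> card {x \<in> H. \<forall>i\<in>supp x. x i = 1} + card (multipartite_edges n c) + 2 * (n * card V)"
    by (rule card_le_by_colouring[OF H few])
  with ones have "card H \<le> card (pairs {..<n} - pairs S) + card (multipartite_edges n c) + 2 * (n * card V)"
    by linarith
  then have "real (card H) \<le> real (card (pairs {..<n} - pairs S)) + real (card (multipartite_edges n c))
      + 2 * (real n * real (card V))"
    unfolding of_nat_le_iff[where ?'a = real, symmetric]
    by (simp only: of_nat_add of_nat_mult of_nat_numeral)
  moreover have "real (card (pairs {..<n} - pairs S)) \<le> ((real n)\<^sup>2 - real n) / 2 - \<delta> * ((real (a (r - 1)))\<^sup>2 - real (a (r - 1))) / 2"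
    unfolding card_pairs_diff[OF S] real_choose_two using \<delta>(1) by (cases \<delta>) (auto simp: S_def a_def)
  moreover have "2 * real (card (multipartite_edges n c)) + (\<Sum>k<r. (real (a k))\<^sup>2) = (real n)\<^sup>2"
    using arg_cong[OF card_multipartite_edges[of n c r, OF c_less], of real] by (simp add: a_def)
  moreover have "(\<Sum>k<r. (real (a k))\<^sup>2) + \<delta> * (real (a (r - 1)))\<^sup>2 \<ge> 2 * (real n)\<^sup>2 / real (2 * r - \<delta>)"
  proof (rule weighted_sum_of_squares_ge)
    show "(\<Sum>k<r. real (a k)) = real n"
      using arg_cong[OF sum_card_classes[of n c r, OF c_less], of real] by (simp add: a_def)
  qed (use r \<delta> in auto)
  moreover have "\<delta> * real (a (r - 1)) \<le> real n"
  proof -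
    have "a (r - 1) \<le> card {..<n}" unfolding a_def by (rule card_mono) auto
    with \<delta>(1) show ?thesis by (cases \<delta>) auto
  qed
  moreover have "\<delta> * ((real (a (r - 1)))\<^sup>2 - real (a (r - 1))) / 2
      = (\<delta> * (real (a (r - 1)))\<^sup>2 - \<delta> * real (a (r - 1))) / 2"
    by (simp add: right_diff_distrib)
  moreover have "2 * (real n)\<^sup>2 / real (2 * r - \<delta>) = 2 * ((real n)\<^sup>2 / real (2 * r - \<delta>))" by simp
  moreover have "(1 + 2 * real (card V)) * real n = real n + 2 * (real n * real (card V))"
    by (simp add: distrib_right)
  moreover have "real n \<ge> 0" by simp
  ultimately show ?thesis by argo
qed

section \<open>Asymptotics\<close>

lemma layered_count_le_ex_num:
  assumes tree: "is_tree V E" and E: "finite E" "E \<noteq> {}" and r: "r \<ge> 1" and c: "\<And>i. i < n \<Longrightarrow> c i < r"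
    and diam: "diameter V E = 2 * r \<or> diameter V E = 2 * r - 1 \<and> {i. i < n \<and> c i = 0} \<subseteq> S"
    and S: "S \<subseteq> {..<n}"
  shows "real (n choose 2) - real (card S choose 2) + real (card (multipartite_edges n c))
           \<le> real (ex_num n V E 2)"
proof -
  have "card (layered n c S) \<le> ex_num n V E 2"
    unfolding ex_num_def
  proof (rule Max_ge[OF ex_num_well_defined(1)[OF E]])
    show "card (layered n c S) \<in> {card H | H. H \<subseteq> qedges n 2 \<and> \<not> contains_s_copy (2 + 1) V E H}"
    proof (intro CollectI exI conjI)
      show "\<not> contains_s_copy (2 + 1) V E (layered n c S)"
        using layered_no_copy[OF tree c diam r] by simp
    qed (simp_all add: layered_subset_qedges)
  qed
  with card_layered_ge[of n S c] card_pairs_diff[OF S] show ?thesis by linarith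
qed

lemma ex_num_le:
  assumes E: "finite E" "E \<noteq> {}"
    and tree: "is_tree V E" and r: "radius V E = r" "r \<ge> 1"
    and \<delta>: "\<delta> \<le> 1" "diameter V E = 2 * r - \<delta>"
  shows "real (ex_num n V E 2)
           \<le> (real n)\<^sup>2 - (real n)\<^sup>2 / real (2 * r - \<delta>) + (1 + 2 * real (card V)) * real n"
proof -
  have "ex_num n V E 2 \<in> {card H | H. H \<subseteq> qedges n 2 \<and> \<not> contains_s_copy (2 + 1) V E H}"
    unfolding ex_num_def by (rule Max_in[OF ex_num_well_defined[OF E]])
  then obtain H where "ex_num n V E 2 = card H" "H \<subseteq> qedges n 2" "\<not> contains_s_copy 3 V E H" by auto
  then show ?thesis using card_le_of_no_copy[OF tree r \<delta>] by simp
qed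

text \<open>The parts of both Turan-type graphs satisfy these size conditions, so their counts attain the
  bound of \<open>card_le_of_no_copy\<close> up to a linear error.\<close>
lemma balanced_count_ge:
  fixes c :: "nat \<Rightarrow> nat"
  assumes r: "r \<ge> 1" and \<delta>: "\<delta> \<le> 1" and c: "\<And>i. i < n \<Longrightarrow> c i < r"
    and parts: "\<And>k. k < r \<Longrightarrow> real (card {i. i < n \<and> c i = k}) \<le> 2 * real n / real (2 * r - \<delta>) + 2"
      "(1 + \<delta>) * real (card {i. i < n \<and> c i = 0}) \<le> 2 * real n / real (2 * r - \<delta>) + 2"
  shows "real (n choose 2) - \<delta> * real (card {i. i < n \<and> c i = 0} choose 2) + real (card (multipartite_edges n c))
           \<ge> (real n)\<^sup>2 - (real n)\<^sup>2 / real (2 * r - \<delta>) - 2 * real n"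
proof -
  define a where "a k = card {i. i < n \<and> c i = k}" for k
  have "2 * real (card (multipartite_edges n c)) + (\<Sum>k<r. (real (a k))\<^sup>2) = (real n)\<^sup>2"
    using arg_cong[OF card_multipartite_edges[of n c r, OF c], of real] by (simp add: a_def)
  moreover have "(\<Sum>k<r. (real (a k))\<^sup>2) + \<delta> * (real (a 0))\<^sup>2 \<le> 2 * (real n)\<^sup>2 / real (2 * r - \<delta>) + 2 * real n"
    by (rule weighted_sum_of_squares_le) (use r \<delta> parts sum_card_classes[of n c r, OF c] in \<open>auto simp: a_def\<close>)
  moreover have "\<delta> * real (a 0 choose 2) \<le> \<delta> * (real (a 0))\<^sup>2 / 2"
    unfolding real_choose_two by (simp add: field_simps)
  ultimately show ?thesis by (simp add: a_def real_choose_two[of n] field_simps)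
qed

text \<open>The difference is at most linear, while \<open>D \<ge> 2\<close> makes \<open>g\<close> grow quadratically.\<close>
lemma asymp_equiv_if_quadratic:
  fixes f g :: "nat \<Rightarrow> real"
  assumes D: "D \<ge> 2" and le: "\<And>n. g n \<le> f n"
    and f: "\<And>n. f n \<le> (real n)\<^sup>2 - (real n)\<^sup>2 / D + K * real n"
    and g: "\<And>n. g n \<ge> (real n)\<^sup>2 - (real n)\<^sup>2 / D - L * real n"
  shows "f \<sim>[at_top] g"
proof -
  have "eventually (\<lambda>n. norm (f n - g n) \<le> (K + L) * norm (real n)) at_top"
  proof (rule always_eventually, rule allI)
    fix n
    have "f n - g n \<le> (K + L) * real n" using f[of n] g[of n] by (simp add: algebra_simps)
    then show "norm (f n - g n) \<le> (K + L) * norm (real n)" using le[of n] by simp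
  qed
  then have "(\<lambda>n. f n - g n) \<in> O(\<lambda>n. real n)" by (rule bigoI)
  also have "(\<lambda>n. real n) \<in> o(\<lambda>n. (real n)\<^sup>2)"
  proof (rule smalloI_tendsto)
    have "(\<lambda>n. real n / (real n)\<^sup>2) = (\<lambda>n. 1 / real n)" by (auto simp: power2_eq_square)
    then show "((\<lambda>n. real n / (real n)\<^sup>2) \<longlongrightarrow> 0) at_top" using lim_1_over_n[where ?'a = real] by simp
    show "eventually (\<lambda>n. (real n)\<^sup>2 \<noteq> 0) at_top"
      using eventually_gt_at_top[of 0] by (rule eventually_mono) simp
  qed
  also have "(\<lambda>n. (real n)\<^sup>2) \<in> O(g)"
  proof (rule bigoI)
    have "eventually (\<lambda>n. real n \<ge> 4 * L) at_top"
      using filterlim_real_sequentially by (simp add: filterlim_at_top)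
    then show "eventually (\<lambda>n. norm ((real n)\<^sup>2) \<le> 4 * norm (g n)) at_top"
    proof (rule eventually_mono)
      fix n assume "real n \<ge> 4 * L"
      then have "4 * L * real n \<le> (real n)\<^sup>2" by (simp add: power2_eq_square mult_right_mono)
      moreover have "(real n)\<^sup>2 / D \<le> (real n)\<^sup>2 / 2" using D by (intro divide_left_mono) auto
      ultimately have "(real n)\<^sup>2 \<le> 4 * g n" using g[of n] by linarith
      then show "norm ((real n)\<^sup>2) \<le> 4 * norm (g n)" by simp
    qed
  qed
  finally show ?thesis by (simp add: asymp_equiv_altdef)
qed

theorem theorem1p5:
  fixes V :: "'a set" and E :: "'a set set" and r :: nat
  assumes "is_tree V E" and "radius V E = r" and "r \<ge> 1"
  shows "(diameter V E = 2 * r \<longrightarrow>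
            (\<lambda>n. real (ex_num n V E 2)) \<sim>[at_top]
            (\<lambda>n. real (n choose 2) + real (turan_num n r)))
       \<and> (diameter V E = 2 * r - 1 \<longrightarrow>
            (\<lambda>n. real (ex_num n V E 2)) \<sim>[at_top]
            (\<lambda>n. real (n choose 2) + real (turan'_num n r)
                  - real ((n div (2 * r - 1)) choose 2)))"
proof (intro conjI impI)
  note tree = assms(1) and rad = assms(2,3)
  have EV: "\<Union> E = V" "V \<noteq> {}" "finite V"
    using tree_Union_edges[OF tree] rad tree by (auto simp: is_tree_def connected_graph_def ugraph_def)
  then have E: "finite E" "E \<noteq> {}" by (auto intro: finite_UnionD)
  {
    assume diam: "diameter V E = 2 * r"
    have parts: "real (card {i. i < n \<and> i mod r = k}) \<le> 2 * real n / real (2 * r) + 2" if "k < r" for n k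
    proof -
      have "real (card {i. i < n \<and> i mod r = k}) \<le> real (n div r) + 1"
        using card_residue_class[OF that, of n] by auto
      moreover have "2 * real n / real (2 * r) = real n / real r" by simp
      moreover have "real (n div r) \<le> real n / real r" by (rule of_nat_div_le_of_nat)
      ultimately show ?thesis by linarith
    qed
    show "(\<lambda>n. real (ex_num n V E 2)) \<sim>[at_top] (\<lambda>n. real (n choose 2) + real (turan_num n r))"
    proof (rule asymp_equiv_if_quadratic[of "real (2 * r)" _ _ "1 + 2 * real (card V)" 2])
      show "real (n choose 2) + real (turan_num n r) \<le> real (ex_num n V E 2)" for n
        using layered_count_le_ex_num[OF tree E rad(2), of n "\<lambda>i. i mod r" "{}"] diam rad(2)
        by (simp add: turan_num_def binomial_eq_0)
      show "(real n)\<^sup>2 - (real n)\<^sup>2 / real (2 * r) - 2 * real n \<le> real (n choose 2) + real (turan_num n r)" for n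
        using balanced_count_ge[OF rad(2), of 0 n "\<lambda>i. i mod r"] parts rad(2)
        by (simp add: turan_num_def)
      show "real (ex_num n V E 2) \<le> (real n)\<^sup>2 - (real n)\<^sup>2 / real (2 * r) + (1 + 2 * real (card V)) * real n" for n
        using ex_num_le[OF E tree rad, of 0 n] diam by simp
    qed (use rad(2) in simp)
  next
    assume diam: "diameter V E = 2 * r - 1"
    define c where "c n = turan'_part n r" for n
    have c: "c n i < r" if "i < n" for n i
      using that rad(2) mod_less_divisor[of "r - 1" "i - n div (2 * r - 1)"]
      by (cases "r = 1") (auto simp: c_def turan'_part_def Let_def simp del: mod_less_divisor)
    have c0: "card {i. i < n \<and> c n i = 0} = n div (2 * r - 1)" for n
      unfolding c_def by (rule card_turan'_part_0)
    have sub: "{i. i < n \<and> c n i = 0} \<subseteq> {..<n}" for n by blast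
    have lower: "real (n choose 2) + real (turan'_num n r) - real ((n div (2 * r - 1)) choose 2)
        \<le> real (ex_num n V E 2)" for n
      using layered_count_le_ex_num[where n = n and c = "c n", OF tree E rad(2) c _ sub] diam
      unfolding turan'_num_def c0 by (fold c_def) auto
    show "(\<lambda>n. real (ex_num n V E 2)) \<sim>[at_top] (\<lambda>n. real (n choose 2) + real (turan'_num n r)
             - real ((n div (2 * r - 1)) choose 2))"
    \<comment> \<open>For \<open>r = 1\<close> the tree is a single edge and both sides vanish identically, so that the
      growth of the right-hand side cannot be used.\<close>
    proof (cases "r = 1")
      case True
      have "ex_num n V E 2 = 0" for n
      proof -
        have empty: "H = {}" if "H \<subseteq> qedges n 2" "\<not> contains_s_copy 3 V E H" for H
        proof (rule ccontr)
          assume "H \<noteq> {}"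
          then obtain x where x: "x \<in> H" by blast
          then have q: "x \<in> qedges n 2" using that(1) by blast
          obtain i j where s: "supp x = {i, j}" by (rule qedges_supp[OF q])
          have "supp x \<subseteq> rich H n (card V) (r - 1)"
            using qedges_2_eq_vec(1,2)[OF q s] True by (simp add: s)
          with no_copy_imp_no_edge_in_rich[OF tree rad diam that(2,1) x] show False by simp
        qed
        have "ex_num n V E 2 \<in> {card H | H. H \<subseteq> qedges n 2 \<and> \<not> contains_s_copy (2 + 1) V E H}"
          unfolding ex_num_def by (rule Max_in[OF ex_num_well_defined[OF E]])
        then obtain H where H: "ex_num n V E 2 = card H" "H \<subseteq> qedges n 2" "\<not> contains_s_copy 3 V E H"
          by auto
        from empty[OF H(2,3)] H(1) show ?thesis by simp
      qed
      moreover have "turan'_num n r = 0" for n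
      proof -
        have "multipartite_edges n (c n) = {}"
          using c[of _ n] True by (fastforce simp: multipartite_edges_def)
        then show ?thesis by (simp add: turan'_num_def c_def)
      qed
      ultimately show ?thesis using True by simp
    next
      case False
      with rad(2) have r2: "r \<ge> 2" by simp
      define D where "D = real (2 * r - 1)"
      have D: "D = 2 * real r - 1" "D \<ge> 2" using r2 by (simp_all add: D_def of_nat_diff)
      have m: "real (n div (2 * r - 1)) \<le> real n / D" for n unfolding D_def by (rule of_nat_div_le_of_nat)
      have parts: "real (card {i. i < n \<and> c n i = k}) \<le> 2 * real n / D + 2" if "k < r" for n k
      proof (cases k)
        case 0
        have "real n / D \<ge> 0" using D by simp
        with m[of n] c0[of n] 0 show ?thesis by simp
      next
        case (Suc j)
        define m where "m = n div (2 * r - 1)"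
        have "card {i. i < n \<and> c n i = k} \<le> (n - m) div (r - 1) + 1"
          using card_turan'_part_Suc[of j r n] that unfolding Suc c_def m_def by fastforce
        then have "real (card {i. i < n \<and> c n i = k}) \<le> real ((n - m) div (r - 1)) + 1" by linarith
        also have "real ((n - m) div (r - 1)) \<le> real (n - m) / real (r - 1)" by (rule of_nat_div_le_of_nat)
        also have "real (n - m) / real (r - 1) \<le> 2 * real n / D + 1"
        proof -
          have "n = m * (2 * r - 1) + n mod (2 * r - 1)" by (simp only: m_def div_mult_mod_eq)
          moreover have "n mod (2 * r - 1) < 2 * r - 1" using r2 by simp
          ultimately have "n < m * (2 * r - 1) + (2 * r - 1)" by linarith
          \<comment> \<open>As \<open>m > n / D - 1\<close>, the other \<open>r - 1\<close> parts share fewer than \<open>n - n / D + 1\<close> vertices.\<close>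
          then have "real n \<le> real (m * (2 * r - 1) + (2 * r - 1))" by (intro of_nat_mono) simp
          then have "real n \<le> (real m + 1) * D"
            by (simp only: D_def of_nat_add of_nat_mult distrib_right mult_1)
          then have "real n / D \<le> real m + 1" using D(2) by (simp add: pos_divide_le_eq)
          moreover have "real (n - m) = real n - real m" by (simp add: m_def of_nat_diff)
          moreover have "real n = real n / D + 2 * (real n / D * (real r - 1))"
          proof -
            have "real n = real n / D * D" using D(2) by simp
            also have "\<dots> = real n / D * (1 + 2 * (real r - 1))" using D(1) by simp
            finally show ?thesis by (simp only: distrib_left mult_1_right mult.left_commute[of _ 2])
          qed
          ultimately have "real (n - m) \<le> 2 * (real n / D * (real r - 1)) + 1" by linarith
          also have "\<dots> \<le> (2 * real n / D + 1) * real (r - 1)" using r2 by (simp add: of_nat_diff algebra_simps)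
          finally show ?thesis using r2 by (simp add: pos_divide_le_eq)
        qed
        finally show ?thesis by simp
      qed
      show ?thesis
      proof (rule asymp_equiv_if_quadratic[OF D(2) lower])
        show "(real n)\<^sup>2 - (real n)\<^sup>2 / D - 2 * real n \<le> real (n choose 2) + real (turan'_num n r)
            - real ((n div (2 * r - 1)) choose 2)" for n
          using balanced_count_ge[OF rad(2), of 1 n "c n"] c parts[of _ n] m[of n] c0[of n]
          by (simp add: turan'_num_def c_def D_def)
        show "real (ex_num n V E 2) \<le> (real n)\<^sup>2 - (real n)\<^sup>2 / D + (1 + 2 * real (card V)) * real n" for n
          using ex_num_le[OF E tree rad, of 1 n] diam by (simp add: D_def)
      qed
    qed
  }
qed

end
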